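(* Let $H$ be a finitely generated strongly verbally closed group. Suppose that at least one of the following conditions holds: (i) all elements of finite order of $H$ lie in the centre $Z(H)$ (in this case, the purity of $Z(H)$ in $H$ is equivalent to the isolatedness of $Z(H)$ in $H$); or (ii) $H$ is not infinitely decomposable. Then the centre $Z(H)$ is a pure subgroup of $H$.
   Context: A subgroup $H$ of a group $G$ is verbally closed in $G$ if every equation of the form $w(x_1,\dots,x_r)=h$, where $w$ is an element of the free group $F(x_1,\dots,x_r)$ and $h\in H$, has a solution in $G$ if and only if it has a solution in $H$. A subgroup $H$ of $G$ is algebraically closed in $G$ if every finite system of equations $\{w_1(x_1,\dots,x_r)=1,\dots,w_m(x_1,\dots,x_r)=1\}$ with coefficients from $H$, i.e. with $w_i\in H*F(x_1,\dots,x_r)$ (free product), has a solution in $G$ if and only if it has a solution in $H$. A group $H$ is strongly verbally closed if it is algebraically closed in every group containing $H$ as a verbally closed subgroup. A subgroup $B$ of a group $A$ is pure if for every integer $n$ and every $b\in B$, the element $b$ is an $n$th power of an element of $A$ if and only if it is an $n$th power of an element of $B$. A subgroup $B$ of $A$ is isolated if $a\in A$ and $a^n\in B$ for some nonzero integer $n$ imply $a\in B$. A group is infinitely decomposable if for every positive integer $n$ it decomposes into a product of $n$ pairwise commuting noncentral subgroups (subgroups $K_1,\dots,K_n$, none contained in the centre, with every element of $K_i$ commuting with every element of $K_j$ for $i\neq j$, and $H=K_1\cdots K_n$). *)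

theory Defs
  imports "HOL-Algebra.Algebra"
begin

section \<open>Equations over groups\<close>

text \<open>
  Elements of the free group \<open>F(x\<^sub>0,\<dots>,x\<^bsub>r-1\<^esub>)\<close> and of the free product \<open>C * F(x\<^sub>0,\<dots>,x\<^bsub>r-1\<^esub>)\<close>
  are represented by (not necessarily reduced) words. Every element is represented by some word,
  and words representing the same element have the same value under every substitution, so
  solvability of an equation does not depend on the representative.
\<close>

datatype 'c letter = Coeff 'c | Var nat | VarInv nat

type_synonym 'c word = "'c letter list"

definition free_product_words :: "'c set \<Rightarrow> nat \<Rightarrow> 'c word set" where
  "free_product_words C r = lists (Coeff ` C \<union> Var ` {..<r} \<union> VarInv ` {..<r})"

definition free_group_words :: "nat \<Rightarrow> 'c word set" where
  "free_group_words r = lists (Var ` {..<r} \<union> VarInv ` {..<r})"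

fun letter_value :: "('a, 'b) monoid_scheme \<Rightarrow> (nat \<Rightarrow> 'a) \<Rightarrow> 'a letter \<Rightarrow> 'a" where
  "letter_value G x (Coeff c) = c"
| "letter_value G x (Var i) = x i"
| "letter_value G x (VarInv i) = inv\<^bsub>G\<^esub> (x i)"

definition word_value :: "('a, 'b) monoid_scheme \<Rightarrow> (nat \<Rightarrow> 'a) \<Rightarrow> 'a word \<Rightarrow> 'a" where
  "word_value G x w = foldr (\<lambda>l a. letter_value G x l \<otimes>\<^bsub>G\<^esub> a) w \<one>\<^bsub>G\<^esub>"

definition verbally_closed :: "('a, 'b) monoid_scheme \<Rightarrow> 'a set \<Rightarrow> bool" where
  "verbally_closed G H \<longleftrightarrow> subgroup H G \<and>
     (\<forall>r. \<forall>w \<in> free_group_words r. \<forall>h \<in> H.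
        (\<exists>x \<in> {..<r} \<rightarrow> carrier G. word_value G x w = h) \<longleftrightarrow>
        (\<exists>x \<in> {..<r} \<rightarrow> H. word_value G x w = h))"

definition algebraically_closed :: "('a, 'b) monoid_scheme \<Rightarrow> 'a set \<Rightarrow> bool" where
  "algebraically_closed G H \<longleftrightarrow> subgroup H G \<and>
     (\<forall>r W. finite W \<and> W \<subseteq> free_product_words H r \<longrightarrow>
        (\<exists>x \<in> {..<r} \<rightarrow> carrier G. \<forall>w \<in> W. word_value G x w = \<one>\<^bsub>G\<^esub>) \<longleftrightarrow>
        (\<exists>x \<in> {..<r} \<rightarrow> H. \<forall>w \<in> W. word_value G x w = \<one>\<^bsub>G\<^esub>))"

text \<open>
  A group containing \<open>H\<close> is given by an embedding \<open>\<phi>\<close> of \<open>H\<close>. A definition in HOL cannot quantify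
  over all types of overgroups, so the overgroups range over groups whose elements are words with
  coefficients in \<open>H\<close>. The lemma \<open>strongly_verbally_closedD\<close> below shows that nothing is lost:
  the property then holds for overgroups over arbitrary types, because a failure of algebraic
  closedness already occurs in a subgroup generated by \<open>H\<close> and finitely many elements.
\<close>

definition strongly_verbally_closed :: "'a monoid \<Rightarrow> bool" where
  "strongly_verbally_closed H \<longleftrightarrow>
     (\<forall>(G :: 'a word monoid) \<phi>.
        group G \<and> \<phi> \<in> hom H G \<and> inj_on \<phi> (carrier H) \<and> verbally_closed G (\<phi> ` carrier H)
        \<longrightarrow> algebraically_closed G (\<phi> ` carrier H))"


section \<open>Centre, purity, isolatedness, decomposability\<close>

definition finitely_generated :: "('a, 'b) monoid_scheme \<Rightarrow> bool" where
  "finitely_generated G \<longleftrightarrow> (\<exists>S. finite S \<and> S \<subseteq> carrier G \<and> generate G S = carrier G)"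

definition centre :: "('a, 'b) monoid_scheme \<Rightarrow> 'a set" where
  "centre G = {z \<in> carrier G. \<forall>g \<in> carrier G. z \<otimes>\<^bsub>G\<^esub> g = g \<otimes>\<^bsub>G\<^esub> z}"

definition pure_subgroup :: "'a set \<Rightarrow> ('a, 'b) monoid_scheme \<Rightarrow> bool" where
  "pure_subgroup B A \<longleftrightarrow> subgroup B A \<and>
     (\<forall>n::int. \<forall>b \<in> B. (\<exists>a \<in> carrier A. a [^]\<^bsub>A\<^esub> n = b) \<longleftrightarrow> (\<exists>c \<in> B. c [^]\<^bsub>A\<^esub> n = b))"

definition isolated_subgroup :: "'a set \<Rightarrow> ('a, 'b) monoid_scheme \<Rightarrow> bool" where
  "isolated_subgroup B A \<longleftrightarrow> subgroup B A \<and>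
     (\<forall>a \<in> carrier A. \<forall>n::int. n \<noteq> 0 \<and> a [^]\<^bsub>A\<^esub> n \<in> B \<longrightarrow> a \<in> B)"

definition torsion_central :: "('a, 'b) monoid_scheme \<Rightarrow> bool" where
  "torsion_central G \<longleftrightarrow>
     (\<forall>g \<in> carrier G. (\<exists>n::nat. n > 0 \<and> g [^]\<^bsub>G\<^esub> n = \<one>\<^bsub>G\<^esub>) \<longrightarrow> g \<in> centre G)"

definition infinitely_decomposable :: "('a, 'b) monoid_scheme \<Rightarrow> bool" where
  "infinitely_decomposable G \<longleftrightarrow>
     (\<forall>n::nat. n > 0 \<longrightarrow> (\<exists>K :: nat \<Rightarrow> 'a set.
        (\<forall>i<n. subgroup (K i) G \<and> \<not> K i \<subseteq> centre G) \<and>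
        (\<forall>i<n. \<forall>j<n. i \<noteq> j \<longrightarrow> (\<forall>a \<in> K i. \<forall>b \<in> K j. a \<otimes>\<^bsub>G\<^esub> b = b \<otimes>\<^bsub>G\<^esub> a)) \<and>
        carrier G = foldr (\<lambda>i P. K i <#>\<^bsub>G\<^esub> P) [0..<n] {\<one>\<^bsub>G\<^esub>}))"


section \<open>Overgroups over arbitrary types\<close>

lemma word_value_Nil [simp]: "word_value G x [] = \<one>\<^bsub>G\<^esub>"
  and word_value_Cons [simp]:
    "word_value G x (l # w) = letter_value G x l \<otimes>\<^bsub>G\<^esub> word_value G x w"
  by (simp_all add: word_value_def)

lemma free_group_words_alt: "free_group_words r = free_product_words {} r"
  by (simp add: free_group_words_def free_product_words_def)

lemma letter_value_closed:
  assumes "group G" "C \<subseteq> K" "subgroup K G" "x \<in> {..<r} \<rightarrow> K"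
    and "l \<in> Coeff ` C \<union> Var ` {..<r} \<union> VarInv ` {..<r}"
  shows "letter_value G x l \<in> K"
  using assms by (auto simp: subgroup.m_inv_closed Pi_iff)

lemma word_value_closed:
  assumes "group G" "C \<subseteq> K" "subgroup K G" "x \<in> {..<r} \<rightarrow> K" "w \<in> free_product_words C r"
  shows "word_value G x w \<in> K"
proof -
  have "w \<in> lists (Coeff ` C \<union> Var ` {..<r} \<union> VarInv ` {..<r})"
    using assms(5) by (simp add: free_product_words_def)
  then show ?thesis
  proof (induction w)
    case Nil
    then show ?case using assms(3) by (simp add: subgroup.one_closed)
  next
    case (Cons l w)
    then show ?case
      using letter_value_closed[OF assms(1-4)] assms(3) by (simp add: subgroup.m_closed)
  qed
qed

lemma word_value_hom:
  assumes "group G" "group G'" "\<psi> \<in> hom G G'" "C \<subseteq> carrier G" "x \<in> {..<r} \<rightarrow> carrier G"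
    and "\<And>i. i < r \<Longrightarrow> y i = \<psi> (x i)" and "w \<in> free_product_words C r"
  shows "word_value G' y (map (map_letter \<psi>) w) = \<psi> (word_value G x w)"
proof -
  interpret group_hom G G' \<psi>
    using assms(1-3) by (simp add: group_hom_def group_hom_axioms_def)
  have "w \<in> lists (Coeff ` C \<union> Var ` {..<r} \<union> VarInv ` {..<r})"
    using assms(7) by (simp add: free_product_words_def)
  then show ?thesis
  proof (induction w)
    case Nil
    then show ?case by simp
  next
    case (Cons l w)
    have w: "word_value G x w \<in> carrier G"
      using Cons.hyps word_value_closed[OF assms(1,4) G.subgroup_self assms(5)]
      by (auto simp: free_product_words_def)
    have l: "letter_value G x l \<in> carrier G"
      using Cons.hyps letter_value_closed[OF assms(1,4) G.subgroup_self assms(5)] by simp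
    have "letter_value G' y (map_letter \<psi> l) = \<psi> (letter_value G x l)"
      using Cons.hyps assms(5,6) by (auto simp: Pi_iff)
    then show ?case using Cons.IH w l by simp
  qed
qed

lemma map_word_free_product:
  assumes "\<psi> ` C \<subseteq> D" "w \<in> free_product_words C r"
  shows "map (map_letter \<psi>) w \<in> free_product_words D r"
  using assms by (fastforce simp: free_product_words_def in_lists_conv_set)

lemma map_word_id:
  assumes "\<And>c. c \<in> C \<Longrightarrow> f (g c) = c" "w \<in> free_product_words C r"
  shows "map (map_letter f) (map (map_letter g) w) = w"
proof -
  have "w \<in> lists (Coeff ` C \<union> Var ` {..<r} \<union> VarInv ` {..<r})"
    using assms(2) by (simp add: free_product_words_def)
  then show ?thesis by (induction w) (auto simp: assms(1))
qed

lemma word_value_restrict: "word_value (G\<lparr>carrier := K\<rparr>) x w = word_value G x w"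
  if "group G" "subgroup K G" "x \<in> {..<r} \<rightarrow> K" "w \<in> free_product_words C r"
proof -
  have "w \<in> lists (Coeff ` C \<union> Var ` {..<r} \<union> VarInv ` {..<r})"
    using that(4) by (simp add: free_product_words_def)
  then show ?thesis
    using that(3) by (induction w) (auto simp: group.m_inv_consistent[OF that(1,2)] Pi_iff)
qed

lemma verbally_closedI:
  assumes sub: "subgroup H G"
    and step: "\<And>r w h y. w \<in> free_product_words {} r \<Longrightarrow> h \<in> H \<Longrightarrow> y \<in> {..<r} \<rightarrow> carrier G \<Longrightarrow>
      word_value G y w = h \<Longrightarrow> \<exists>x \<in> {..<r} \<rightarrow> H. word_value G x w = h"
  shows "verbally_closed G H"
proof -
  have "{..<r} \<rightarrow> H \<subseteq> {..<r} \<rightarrow> carrier G" for r :: nat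
    using subgroup.subset[OF sub] by (rule Pi_mono)
  then have "(\<exists>x \<in> {..<r} \<rightarrow> carrier G. word_value G x w = h) \<longleftrightarrow>
      (\<exists>x \<in> {..<r} \<rightarrow> H. word_value G x w = h)"
    if "w \<in> free_product_words {} r" "h \<in> H" for r w h
    using step[OF that] by (meson subsetD)
  then show ?thesis using sub by (simp add: verbally_closed_def free_group_words_alt)
qed

lemma algebraically_closedI:
  assumes sub: "subgroup H G"
    and step: "\<And>r W y. finite W \<Longrightarrow> W \<subseteq> free_product_words H r \<Longrightarrow> y \<in> {..<r} \<rightarrow> carrier G \<Longrightarrow>
      \<forall>w \<in> W. word_value G y w = \<one>\<^bsub>G\<^esub> \<Longrightarrow> \<exists>x \<in> {..<r} \<rightarrow> H. \<forall>w \<in> W. word_value G x w = \<one>\<^bsub>G\<^esub>"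
  shows "algebraically_closed G H"
proof -
  have "{..<r} \<rightarrow> H \<subseteq> {..<r} \<rightarrow> carrier G" for r :: nat
    using subgroup.subset[OF sub] by (rule Pi_mono)
  then have "(\<exists>x \<in> {..<r} \<rightarrow> carrier G. \<forall>w \<in> W. word_value G x w = \<one>\<^bsub>G\<^esub>) \<longleftrightarrow>
      (\<exists>x \<in> {..<r} \<rightarrow> H. \<forall>w \<in> W. word_value G x w = \<one>\<^bsub>G\<^esub>)"
    if "finite W" "W \<subseteq> free_product_words H r" for r W
    using step[OF that] by (meson subsetD)
  then show ?thesis using sub by (simp add: algebraically_closed_def)
qed

lemma algebraically_closedD:
  assumes "algebraically_closed G H" "finite W" "W \<subseteq> free_product_words H r"
    and "y \<in> {..<r} \<rightarrow> carrier G" "\<And>w. w \<in> W \<Longrightarrow> word_value G y w = \<one>\<^bsub>G\<^esub>"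
  obtains x where "x \<in> {..<r} \<rightarrow> H" "\<And>w. w \<in> W \<Longrightarrow> word_value G x w = \<one>\<^bsub>G\<^esub>"
proof -
  have "\<exists>y \<in> {..<r} \<rightarrow> carrier G. \<forall>w \<in> W. word_value G y w = \<one>\<^bsub>G\<^esub>"
    using assms(4,5) by (intro bexI[of _ y] ballI)
  then have "\<exists>x \<in> {..<r} \<rightarrow> H. \<forall>w \<in> W. word_value G x w = \<one>\<^bsub>G\<^esub>"
    using assms(1-3) by (simp add: algebraically_closed_def)
  then show ?thesis using that by auto
qed

text \<open>Verbal and algebraic closedness are invariant under isomorphism of the overgroup.\<close>

lemma verbally_closed_iso:
  assumes G: "group G" and G': "group G'" and iso: "\<psi> \<in> iso G G'" and vc: "verbally_closed G H"
  shows "verbally_closed G' (\<psi> ` H)"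
proof -
  have hom: "\<psi> \<in> hom G G'" and bij: "bij_betw \<psi> (carrier G) (carrier G')"
    using iso by (auto simp: iso_def)
  have H: "subgroup H G" using vc by (simp add: verbally_closed_def)
  then have HG: "H \<subseteq> carrier G" by (rule subgroup.subset)
  define \<theta> where "\<theta> = inv_into (carrier G) \<psi>"
  have \<theta>: "\<theta> \<in> iso G' G" unfolding \<theta>_def by (rule group.iso_set_sym[OF G iso])
  then have homt: "\<theta> \<in> hom G' G" by (auto simp: iso_def)
  have tp: "\<theta> (\<psi> a) = a" if "a \<in> carrier G" for a
    using bij that by (simp add: \<theta>_def bij_betw_def)
  have sub: "subgroup (\<psi> ` H) G'"
    using group_hom.subgroup_img_is_subgroup[of G G' \<psi> H] G G' hom H
    by (simp add: group_hom_def group_hom_axioms_def)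
  have "\<exists>x \<in> {..<r} \<rightarrow> \<psi> ` H. word_value G' x w = h"
    if w: "w \<in> free_product_words {} r" and h: "h \<in> \<psi> ` H"
      and y: "y \<in> {..<r} \<rightarrow> carrier G'" and yw: "word_value G' y w = h" for r w h y
  proof -
    let ?w = "map (map_letter \<theta>) w"
    have w': "?w \<in> free_product_words {} r" by (rule map_word_free_product[OF _ w]) simp
    have "word_value G (\<lambda>i. \<theta> (y i)) ?w = \<theta> h"
      using word_value_hom[OF G' G homt _ y _ w, of "\<lambda>i. \<theta> (y i)"] yw by simp
    moreover have "(\<lambda>i. \<theta> (y i)) \<in> {..<r} \<rightarrow> carrier G"
      using y homt by (auto simp: hom_def Pi_iff)
    moreover have "\<theta> h \<in> H" using h tp HG by auto
    ultimately obtain x where x: "x \<in> {..<r} \<rightarrow> H" "word_value G x ?w = \<theta> h"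
      using vc w' unfolding verbally_closed_def free_group_words_alt by blast
    have "word_value G' (\<lambda>i. \<psi> (x i)) (map (map_letter \<psi>) ?w) = \<psi> (\<theta> h)"
      using word_value_hom[OF G G' hom, of "{}" x r "\<lambda>i. \<psi> (x i)" ?w] x w' HG by auto
    moreover have "map (map_letter \<psi>) ?w = w" by (rule map_word_id[OF _ w]) simp
    moreover have "\<psi> (\<theta> h) = h" using h tp HG by auto
    ultimately show ?thesis using x(1) by (intro bexI[of _ "\<lambda>i. \<psi> (x i)"]) auto
  qed
  then show ?thesis by (intro verbally_closedI sub)
qed

lemma algebraically_closed_iso:
  assumes G: "group G" and G': "group G'" and iso: "\<psi> \<in> iso G G'"
    and ac: "algebraically_closed G H"
  shows "algebraically_closed G' (\<psi> ` H)"
proof -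
  have hom: "\<psi> \<in> hom G G'" and bij: "bij_betw \<psi> (carrier G) (carrier G')"
    using iso by (auto simp: iso_def)
  have H: "subgroup H G" using ac by (simp add: algebraically_closed_def)
  then have HG: "H \<subseteq> carrier G" by (rule subgroup.subset)
  define \<theta> where "\<theta> = inv_into (carrier G) \<psi>"
  have \<theta>: "\<theta> \<in> iso G' G" unfolding \<theta>_def by (rule group.iso_set_sym[OF G iso])
  then have homt: "\<theta> \<in> hom G' G" by (auto simp: iso_def)
  have tp: "\<theta> (\<psi> a) = a" if "a \<in> carrier G" for a
    using bij that by (simp add: \<theta>_def bij_betw_def)
  have sub: "subgroup (\<psi> ` H) G'"
    using group_hom.subgroup_img_is_subgroup[of G G' \<psi> H] G G' hom H
    by (simp add: group_hom_def group_hom_axioms_def)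
  then have subG': "\<psi> ` H \<subseteq> carrier G'" by (rule subgroup.subset)
  have one: "\<theta> \<one>\<^bsub>G'\<^esub> = \<one>\<^bsub>G\<^esub>" "\<psi> \<one>\<^bsub>G\<^esub> = \<one>\<^bsub>G'\<^esub>"
    using hom_one[OF homt G' G] hom_one[OF hom G G'] by auto
  have "\<exists>x \<in> {..<r} \<rightarrow> \<psi> ` H. \<forall>w \<in> W. word_value G' x w = \<one>\<^bsub>G'\<^esub>"
    if fin: "finite W" and W: "W \<subseteq> free_product_words (\<psi> ` H) r"
      and y: "y \<in> {..<r} \<rightarrow> carrier G'" and yw: "\<forall>w \<in> W. word_value G' y w = \<one>\<^bsub>G'\<^esub>" for r W y
  proof -
    let ?W = "map (map_letter \<theta>) ` W"
    have "\<theta> ` \<psi> ` H \<subseteq> H" using tp HG by auto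
    then have W': "?W \<subseteq> free_product_words H r" using W map_word_free_product by blast
    have yt: "word_value G (\<lambda>i. \<theta> (y i)) (map (map_letter \<theta>) w) = \<one>\<^bsub>G\<^esub>" if "w \<in> W" for w
    proof -
      have "word_value G (\<lambda>i. \<theta> (y i)) (map (map_letter \<theta>) w) = \<theta> (word_value G' y w)"
        by (rule word_value_hom[OF G' G homt subG' y]) (use that W in auto)
      then show ?thesis using yw that one by simp
    qed
    have "(\<lambda>i. \<theta> (y i)) \<in> {..<r} \<rightarrow> carrier G"
      using y homt by (auto simp: hom_def Pi_iff)
    then obtain x where x: "x \<in> {..<r} \<rightarrow> H" "\<And>w. w \<in> ?W \<Longrightarrow> word_value G x w = \<one>\<^bsub>G\<^esub>"
      by (rule algebraically_closedD[OF ac finite_imageI[OF fin] W']) (use yt in blast)+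
    have "word_value G' (\<lambda>i. \<psi> (x i)) w = \<one>\<^bsub>G'\<^esub>" if w: "w \<in> W" for w
    proof -
      have "map (map_letter \<psi>) (map (map_letter \<theta>) w) = w"
      proof (rule map_word_id)
        show "w \<in> free_product_words (\<psi> ` H) r" using w W by blast
        show "\<psi> (\<theta> c) = c" if "c \<in> \<psi> ` H" for c using that tp HG by auto
      qed
      moreover have "word_value G' (\<lambda>i. \<psi> (x i)) (map (map_letter \<psi>) (map (map_letter \<theta>) w)) =
          \<psi> (word_value G x (map (map_letter \<theta>) w))"
      proof (rule word_value_hom[OF G G' hom HG])
        show "x \<in> {..<r} \<rightarrow> carrier G" using x(1) HG by auto
        show "map (map_letter \<theta>) w \<in> free_product_words H r" using w W' by blast
      qed simp
      ultimately show ?thesis using x(2) w one by simp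
    qed
    then show ?thesis using x(1) by (intro bexI[of _ "\<lambda>i. \<psi> (x i)"]) auto
  qed
  then show ?thesis by (intro algebraically_closedI sub)
qed

lemma strongly_verbally_closedD:
  fixes H :: "'a monoid" and G :: "'g monoid"
  assumes H: "group H" and svc: "strongly_verbally_closed H"
    and G: "group G" and \<phi>: "\<phi> \<in> hom H G" "inj_on \<phi> (carrier H)"
    and vc: "verbally_closed G (\<phi> ` carrier H)"
  shows "algebraically_closed G (\<phi> ` carrier H)"
proof -
  let ?H = "\<phi> ` carrier H"
  interpret G: group G by fact
  have sub: "subgroup ?H G" using vc by (simp add: verbally_closed_def)
  then have HG: "?H \<subseteq> carrier G" by (rule subgroup.subset)
  have "\<exists>x \<in> {..<r} \<rightarrow> ?H. \<forall>w \<in> W. word_value G x w = \<one>\<^bsub>G\<^esub>"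
    if fin: "finite W" and W: "W \<subseteq> free_product_words ?H r"
      and y: "y \<in> {..<r} \<rightarrow> carrier G" and yw: "\<forall>w \<in> W. word_value G y w = \<one>\<^bsub>G\<^esub>" for r W y
  proof -
    define S where "S = ?H \<union> y ` {..<r}"
    define K where "K = generate G S"
    have S: "S \<subseteq> carrier G" using HG y by (auto simp: S_def)
    have K: "subgroup K G" unfolding K_def by (rule G.generate_is_subgroup[OF S])
    then have KG: "K \<subseteq> carrier G" by (rule subgroup.subset)
    have SK: "S \<subseteq> K" by (auto simp: K_def intro: generate.incl)
    let ?G1 = "G\<lparr>carrier := K\<rparr>"
    have G1: "group ?G1" by (rule G.subgroup_imp_group[OF K])
    have HK: "?H \<subseteq> K" using SK by (auto simp: S_def)
    have yK: "y \<in> {..<r} \<rightarrow> K" using SK by (auto simp: S_def)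
    have sub1: "subgroup ?H ?G1" by (rule G.subgroup_incl[OF sub K HK])

    have vc1: "verbally_closed ?G1 ?H"
    proof -
      have "\<exists>x \<in> {..<s} \<rightarrow> ?H. word_value ?G1 x w = h"
        if w: "w \<in> free_product_words {} s" and h: "h \<in> ?H"
          and z: "z \<in> {..<s} \<rightarrow> K" and zw: "word_value ?G1 z w = h" for s w h z
      proof -
        have "word_value G z w = h" using zw word_value_restrict[OF G K z w] by simp
        moreover have "z \<in> {..<s} \<rightarrow> carrier G" using z KG by auto
        ultimately obtain x where x: "x \<in> {..<s} \<rightarrow> ?H" "word_value G x w = h"
          using vc w h unfolding verbally_closed_def free_group_words_alt by blast
        have "x \<in> {..<s} \<rightarrow> K" using x HK by auto
        then have "word_value ?G1 x w = h" using x(2) word_value_restrict[OF G K _ w] by simp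
        then show ?thesis using x(1) by (rule bexI)
      qed
      then show ?thesis
        by (intro verbally_closedI sub1) simp
    qed

    define val where "val w = word_value G y (map (map_letter \<phi>) w)" for w :: "'a word"
    have val_app: "val (u @ v) = val u \<otimes>\<^bsub>G\<^esub> val v" and val_cl: "val u \<in> carrier G"
      if "u \<in> free_product_words (carrier H) r" "v \<in> free_product_words (carrier H) r" for u v
    proof -
      have cl: "val u \<in> carrier G" if "u \<in> free_product_words (carrier H) r" for u
        unfolding val_def
        by (rule word_value_closed[OF G HG G.subgroup_self y])
          (rule map_word_free_product[OF subset_refl that])
      show "val u \<in> carrier G" by (rule cl[OF that(1)])
      have "u \<in> lists (Coeff ` carrier H \<union> Var ` {..<r} \<union> VarInv ` {..<r})"
        using that(1) by (simp add: free_product_words_def)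
      then show "val (u @ v) = val u \<otimes>\<^bsub>G\<^esub> val v"
      proof (induction u)
        case Nil
        then show ?case using cl[OF that(2)] by (simp add: val_def)
      next
        case (Cons l u)
        have "u \<in> free_product_words (carrier H) r"
          using Cons.hyps by (auto simp: free_product_words_def)
        from cl[OF this] have "val u \<in> carrier G" .
        moreover have "letter_value G y (map_letter \<phi> l) \<in> carrier G"
          by (rule letter_value_closed[OF G HG G.subgroup_self y]) (use Cons.hyps in auto)
        ultimately show ?case using Cons.IH cl[OF that(2)] by (simp add: val_def G.m_assoc)
      qed
    qed
    have surj: "K \<subseteq> val ` free_product_words (carrier H) r"
    proof
      fix a assume "a \<in> K"
      then have "a \<in> generate G S" by (simp add: K_def)
      then show "a \<in> val ` free_product_words (carrier H) r"
      proof induction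
        case one
        then show ?case
          by (intro image_eqI[of _ _ "[]"]) (auto simp: val_def free_product_words_def)
      next
        case (incl s)
        then consider h where "h \<in> carrier H" "s = \<phi> h" | i where "i < r" "s = y i"
          by (auto simp: S_def)
        then show ?case
        proof cases
          case 1
          then show ?thesis using HG
            by (intro image_eqI[of _ _ "[Coeff h]"]) (auto simp: val_def free_product_words_def)
        next
          case 2
          then show ?thesis using y
            by (intro image_eqI[of _ _ "[Var i]"]) (auto simp: val_def free_product_words_def Pi_iff)
        qed
      next
        case (inv s)
        then consider h where "h \<in> carrier H" "s = \<phi> h" | i where "i < r" "s = y i"
          by (auto simp: S_def)
        then show ?case
        proof cases
          case 1
          interpret \<phi>: group_hom H G \<phi>
            using H G \<phi> by (simp add: group_hom_def group_hom_axioms_def)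
          show ?thesis using 1 HG
            by (intro image_eqI[of _ _ "[Coeff (inv\<^bsub>H\<^esub> h)]"])
              (auto simp: val_def free_product_words_def)
        next
          case 2
          then show ?thesis using y
            by (intro image_eqI[of _ _ "[VarInv i]"])
              (auto simp: val_def free_product_words_def Pi_iff)
        qed
      next
        case (eng a b)
        then obtain u v where "u \<in> free_product_words (carrier H) r" "a = val u"
          "v \<in> free_product_words (carrier H) r" "b = val v" by auto
        then show ?case using val_app
          by (intro image_eqI[of _ _ "u @ v"]) (auto simp: free_product_words_def)
      qed
    qed

    define j where "j = inv_into (free_product_words (carrier H) r) val"
    have jK: "val (j a) = a" if "a \<in> K" for a
      using surj that by (auto simp: j_def f_inv_into_f)
    have inj: "inj_on j K" by (metis inj_onI jK)
    define G2 where "G2 = \<lparr>carrier = j ` K,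
      monoid.mult = (\<lambda>u v. j (val u \<otimes>\<^bsub>G\<^esub> val v)), one = j \<one>\<^bsub>G\<^esub>\<rparr>"
    have j_hom: "j \<in> hom ?G1 G2" by (auto simp: hom_def G2_def jK)
    have j_iso: "j \<in> iso ?G1 G2" using j_hom inj by (auto simp: iso_def bij_betw_def G2_def)
    have G2: "group G2"
    proof -
      have "group (G2\<lparr>carrier := j ` carrier ?G1, one := j \<one>\<^bsub>?G1\<^esub>\<rparr>)"
        by (rule group.hom_imp_img_group[OF G1 j_hom])
      then show ?thesis by (simp add: G2_def)
    qed
    have "verbally_closed G2 (j ` ?H)" by (rule verbally_closed_iso[OF G1 G2 j_iso vc1])
    moreover have "(j \<circ> \<phi>) \<in> hom H G2"
      using \<phi>(1) HK by (intro hom_compose[OF _ j_hom]) (auto simp: hom_def)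
    moreover have "inj_on (j \<circ> \<phi>) (carrier H)"
      using \<phi>(2) inj HK by (meson comp_inj_on inj_on_subset)
    ultimately have "algebraically_closed G2 (j ` ?H)"
      using svc G2 unfolding strongly_verbally_closed_def image_comp by blast
    moreover have "inv_into K j \<in> iso G2 ?G1" using group.iso_set_sym[OF G1 j_iso] by simp
    ultimately have "algebraically_closed ?G1 (inv_into K j ` j ` ?H)"
      by (intro algebraically_closed_iso[OF G2 G1])
    moreover have "inv_into K j ` j ` ?H = ?H" using inj HK by simp
    ultimately have ac1: "algebraically_closed ?G1 ?H" by simp
    have eq: "word_value ?G1 x w = word_value G x w" if "x \<in> {..<r} \<rightarrow> K" "w \<in> W" for x w
      using word_value_restrict[OF G K that(1)] that(2) W by blast
    obtain x where x: "x \<in> {..<r} \<rightarrow> ?H" "\<And>w. w \<in> W \<Longrightarrow> word_value ?G1 x w = \<one>\<^bsub>?G1\<^esub>"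
      by (rule algebraically_closedD[OF ac1 fin W, of y]) (use yK yw eq in auto)
    moreover have "x \<in> {..<r} \<rightarrow> K" using x(1) HK by auto
    ultimately show ?thesis using eq by auto
  qed
  then show ?thesis by (intro algebraically_closedI sub)
qed

end

theory Submission
  imports Defs "HOL-Library.Ramsey"
begin

text \<open>
  Suppose that \<open>z = h\<^sup>n\<close> is central. Adjoin a central \<open>n\<close>-th root \<open>\<zeta>\<close> of \<open>z\<close> to \<open>H\<close>, and consider the group of
  \<open>m\<close>-tuples \<open>(h\<^sub>l \<zeta>\<^bsup>E l\<^esup>)\<close> where \<open>E\<close> runs through a lattice \<open>\<Lambda>\<close> of integer vectors each of which has a
  coordinate divisible by \<open>n\<close>. Then the diagonal copy of \<open>H\<close> is verbally closed, hence algebraically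
  closed. As \<open>H\<close> is finitely generated, the finite system saying that the generators are products of
  \<open>m\<close> commuting factors, and that each product of the \<open>E i\<close>-th powers of the copies of \<open>z\<close> in these
  factors has a central \<open>n\<close>-th root, is solvable in \<open>H\<close>.
  Thus \<open>H\<close> is a product of commuting subgroups \<open>K\<^sub>i\<close>, with \<open>h = \<Prod>\<^sub>i t\<^sub>i\<close>, \<open>t\<^sub>i \<in> K\<^sub>i\<close>, such that
  \<open>\<Prod>\<^sub>i t\<^sub>i\<^bsup>n (E i)\<^esup>\<close> is the \<open>n\<close>-th power of a central element. Ramsey's theorem provides a \<open>\<Lambda>\<close> in
  which any fewer than \<open>N\<close> coordinates are simultaneously \<open>1\<close> for some vector. If fewer than \<open>N\<close> of the
  \<open>K\<^sub>i\<close> are noncentral, \<open>z\<close> is therefore the \<open>n\<close>-th power of a central element; otherwise \<open>H\<close>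
  decomposes into \<open>N\<close> commuting noncentral subgroups. If the torsion of \<open>H\<close> is central, then
  \<open>\<Prod>\<^sub>i t\<^sub>i\<^bsup>E i\<^esup>\<close> is central, hence so are all \<open>t\<^sub>i\<close>, and \<open>h\<close>.
\<close>

section \<open>Covering lattices\<close>

text \<open>Ramsey's theorem with the residues modulo n as colours: all L subsets of B of size
  \<open>L - 1\<close> share one residue, so the sum is congruent to a multiple of L, and n divides
  L. The bound \<open>M\<close> is uniform in \<open>col\<close>.\<close>

lemma monochromatic_sum:
  fixes n L :: nat
  assumes "n > 0" "L > 0" "n dvd L"
  obtains M :: nat where "\<And>col :: nat set \<Rightarrow> int.
    \<exists>B \<in> nsets {..<M} L. int n dvd (\<Sum>v \<in> nsets B (L - 1). col v)"
proof -
  obtain M :: nat where M: "partn_lst {..<M} (replicate n L) (L - 1)"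
    using ramsey_full by blast
  have "\<exists>B \<in> nsets {..<M} L. int n dvd (\<Sum>v \<in> nsets B (L - 1). col v)"
    for col :: "nat set \<Rightarrow> int"
  proof -
    define f where "f v = nat (col v mod int n)" for v
    have "f \<in> nsets {..<M} (L - 1) \<rightarrow> {..<length (replicate n L)}"
      using assms(1) by (auto simp: f_def nat_less_iff)
    then obtain i B where i: "i < n" and B: "B \<in> nsets {..<M} L"
      and mono: "f ` nsets B (L - 1) \<subseteq> {i}"
      using M by (auto simp: partn_lst_def monochromatic_def)
    have "int n dvd col v - int i" if "v \<in> nsets B (L - 1)" for v
    proof -
      have "nat (col v mod int n) = i" using that mono by (auto simp: f_def)
      then have "col v mod int n = int i mod int n" using i assms(1) by auto
      then show ?thesis by (simp add: mod_eq_dvd_iff)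
    qed
    then have "int n dvd (\<Sum>v \<in> nsets B (L - 1). col v - int i)" by (rule dvd_sum)
    moreover have "card (nsets B (L - 1)) = L"
      using B assms(2) binomial_symmetric[of 1 L] by (auto simp: nsets_def[of "{..<M}"])
    ultimately have "int n dvd (\<Sum>v \<in> nsets B (L - 1). col v) - int L * int i"
      by (simp add: sum_subtractf)
    moreover have "int n dvd int L * int i" using assms(3) by simp
    ultimately show ?thesis using B by (metis diff_add_cancel dvd_add)
  qed
  then show thesis by (rule that)
qed

text \<open>Counting: B has L subsets of size \<open>L - 1\<close>, but fewer than L sets have the
  form \<open>B \<inter> Y\<close> with Y in I. A subset that is not of this form lies in no other
  member Y, since its size would force it to equal \<open>B \<inter> Y\<close>.\<close>

lemma private_subset:
  fixes L :: nat
  assumes I: "finite I" "card I < L" "B \<in> I"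
    and L: "\<And>Y. Y \<in> I \<Longrightarrow> finite Y \<and> card Y = L"
  shows "\<exists>v \<in> nsets B (L - 1). \<forall>Y \<in> I. v \<subseteq> Y \<longrightarrow> Y = B"
proof -
  have B: "finite B" "card B = L" and pos: "L > 0" using I L by auto
  have "card ((\<inter>) B ` I) < L" using card_image_le[OF I(1)] I(2) by (rule le_less_trans)
  moreover have "card (nsets B (L - 1)) = L"
    using B pos binomial_symmetric[of 1 L] by simp
  ultimately have "\<not> nsets B (L - 1) \<subseteq> (\<inter>) B ` I"
    using card_mono[OF finite_imageI[OF I(1)], of "nsets B (L - 1)"] by (metis leD)
  then obtain v where v: "v \<in> nsets B (L - 1)" "v \<notin> (\<inter>) B ` I" by (meson subsetI)
  have "Y = B" if Y: "Y \<in> I" "v \<subseteq> Y" for Y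
  proof (rule ccontr)
    assume "Y \<noteq> B"
    have "\<not> B \<subseteq> Y" using \<open>Y \<noteq> B\<close> B(2) L[OF Y(1)] card_subset_eq[of Y B] by auto
    then have "card (B \<inter> Y) < L" using psubset_card_mono[of B "B \<inter> Y"] B by auto
    moreover have sub: "v \<subseteq> B \<inter> Y" using v(1) Y(2) by (auto simp: nsets_def)
    moreover have "card v = L - 1" using v(1) by (auto simp: nsets_def)
    ultimately have "v = B \<inter> Y" using B(1) card_seteq[of "B \<inter> Y" v] by simp
    then show False using v(2) Y(1) by blast
  qed
  then show ?thesis using v(1) by blast
qed

text \<open>
  The coordinates are the \<open>L\<close>-subsets \<open>B\<close> of a large set; an integer colouring of the
  \<open>(L-1)\<close>-subsets gives the vector whose \<open>B\<close>-coordinate is the sum of the colours of the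
  \<open>(L-1)\<close>-subsets of \<open>B\<close>. By Ramsey some \<open>B\<close> is monochromatic modulo \<open>n\<close>, and \<open>n\<close> divides \<open>L\<close>.
\<close>

lemma covering_code:
  fixes n N :: nat
  assumes n: "n > 0"
  obtains m :: nat and a :: "nat \<Rightarrow> nat \<Rightarrow> nat" and s :: nat
  where "\<And>e :: nat \<Rightarrow> int. \<exists>i<m. int n dvd (\<Sum>k<s. e k * int (a k i))"
    and "\<And>I. I \<subseteq> {..<m} \<Longrightarrow> card I < N \<Longrightarrow> \<exists>k<s. \<forall>i \<in> I. a k i = 1"
proof -
  \<comment> \<open>A multiple of n for the Ramsey argument, and larger than N so that families with
    fewer than N members have private subsets.\<close>
  define L where "L = n * (N + 1)"
  have L: "L > 0" "n dvd L" using n by (auto simp: L_def)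
  have NL: "N < L" using n mult_le_mono1[of 1 n "N + 1"] by (simp add: L_def)
  obtain M :: nat where M: "\<And>col :: nat set \<Rightarrow> int.
    \<exists>B \<in> nsets {..<M} L. int n dvd (\<Sum>v \<in> nsets B (L - 1). col v)"
    using monochromatic_sum[OF n L] by blast
  define XX where "XX = nsets {..<M} L"
  define II where "II = {I. I \<subseteq> XX \<and> card I < N}"
  have finX: "finite XX" by (simp add: XX_def finite_imp_finite_nsets)
  then have finI: "finite II" by (simp add: II_def)
  have XL: "finite Y \<and> card Y = L" if "Y \<in> XX" for Y using that by (auto simp: XX_def nsets_def)
  have "\<exists>v. v \<in> nsets B (L - 1) \<and> (\<forall>Y \<in> I. v \<subseteq> Y \<longrightarrow> Y = B)" if "I \<in> II" "B \<in> I" for I B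
    using private_subset[of I L B] that finX XL NL finite_subset[of I XX]
    by (auto simp: II_def Bex_def subset_eq)
  then obtain p where p: "\<And>I B. I \<in> II \<Longrightarrow> B \<in> I \<Longrightarrow> p I B \<in> nsets B (L - 1)"
    "\<And>I B Y. I \<in> II \<Longrightarrow> B \<in> I \<Longrightarrow> Y \<in> I \<Longrightarrow> p I B \<subseteq> Y \<Longrightarrow> Y = B"
    by metis
  \<comment> \<open>The generator attached to I belongs to the colouring that is 1 on the chosen
    private subsets and 0 elsewhere. A member of I contains only its own private subset, so its
    coordinate is 1.\<close>
  define A where "A I B = card (nsets B (L - 1) \<inter> p I ` I)" for I B
  have A1: "A I B = 1" if "I \<in> II" "B \<in> I" for I B
  proof -
    have "nsets B (L - 1) \<inter> p I ` I = {p I B}"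
      using p[OF that(1)] that(2) by (fastforce simp: nsets_def)
    then show ?thesis by (simp add: A_def)
  qed
  have cover: "\<exists>B \<in> XX. int n dvd (\<Sum>I \<in> II. e I * int (A I B))" for e :: "nat set set \<Rightarrow> int"
  proof -
    \<comment> \<open>An integer combination of generators comes from the same combination of their
      colourings, to which the Ramsey bound applies.\<close>
    define col where "col v = (\<Sum>I \<in> II. e I * of_bool (v \<in> p I ` I))" for v
    obtain B where B: "B \<in> XX" "int n dvd (\<Sum>v \<in> nsets B (L - 1). col v)"
      using M XX_def by blast
    have fin: "finite (nsets B (L - 1))" using XL[OF B(1)] by (simp add: finite_imp_finite_nsets)
    have "(\<Sum>v \<in> nsets B (L - 1). col v) =
        (\<Sum>I \<in> II. \<Sum>v \<in> nsets B (L - 1). e I * of_bool (v \<in> p I ` I))"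
      unfolding col_def by (rule sum.swap)
    also have "\<dots> = (\<Sum>I \<in> II. e I * int (A I B))"
      using fin by (simp add: A_def sum_distrib_left[symmetric] of_bool_def sum.If_cases Int_def)
    finally show ?thesis using B by auto
  qed
  obtain b where b: "bij_betw b {..<card XX} XX"
    using ex_bij_betw_nat_finite[OF finX] by (auto simp: atLeast0LessThan)
  obtain c where c: "bij_betw c {..<card II} II"
    using ex_bij_betw_nat_finite[OF finI] by (auto simp: atLeast0LessThan)
  define c' where "c' = inv_into {..<card II} c"
  have c': "c' (c k) = k" if "k < card II" for k
    using c that by (simp add: c'_def bij_betw_def)
  show thesis
  proof (rule that[where m = "card XX" and s = "card II" and a = "\<lambda>k i. A (c k) (b i)"])
    fix e :: "nat \<Rightarrow> int"
    obtain B where B: "B \<in> XX" "int n dvd (\<Sum>I \<in> II. e (c' I) * int (A I B))"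
      using cover[of "\<lambda>I. e (c' I)"] by blast
    have "B \<in> b ` {..<card XX}" using B(1) b by (simp add: bij_betw_def)
    then obtain i where i: "i < card XX" "b i = B" by auto
    have "(\<Sum>I \<in> II. e (c' I) * int (A I B)) = (\<Sum>k<card II. e k * int (A (c k) B))"
      using sum.reindex_bij_betw[OF c, of "\<lambda>I. e (c' I) * int (A I B)"] c' by simp
    then show "\<exists>i<card XX. int n dvd (\<Sum>k<card II. e k * int (A (c k) (b i)))"
      using B(2) i by auto
  next
    fix I assume I: "I \<subseteq> {..<card XX}" "card I < N"
    have "b ` I \<subseteq> XX" using I(1) b by (auto simp: bij_betw_def)
    moreover have "card (b ` I) < N"
      using I finite_subset[OF I(1)] card_image_le[of I b] by simp
    ultimately have bI: "b ` I \<in> II" by (simp add: II_def)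
    then have "b ` I \<in> c ` {..<card II}" using c by (simp add: bij_betw_def)
    then obtain k where "k < card II" "c k = b ` I" by auto
    then show "\<exists>k<card II. \<forall>i \<in> I. A (c k) (b i) = 1" using A1 bI by auto
  qed
qed

text \<open>Induction with Bezout's identity for two integers. The sum is, up to sign, a greatest
  common divisor of the \<open>d i\<close>; its coefficients are needed as well, to absorb a central
  power into the arguments of a word.\<close>

lemma bezout_sum:
  fixes d :: "nat \<Rightarrow> int"
  shows "\<exists>s. \<forall>i<r. (\<Sum>j<r. d j * s j) dvd d i"
proof (induction r)
  case (Suc r)
  then obtain s where s: "\<And>i. i < r \<Longrightarrow> (\<Sum>j<r. d j * s j) dvd d i" by blast
  define g where "g = (\<Sum>j<r. d j * s j)"
  obtain u v where uv: "u * g + v * d r = gcd g (d r)" using bezout_int by blast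
  define s' where "s' j = (if j = r then v else u * s j)" for j
  have "(\<Sum>j<Suc r. d j * s' j) = (\<Sum>j<r. u * (d j * s j)) + d r * v"
    by (simp add: s'_def mult.left_commute)
  also have "\<dots> = gcd g (d r)" using uv by (simp add: g_def sum_distrib_left mult.commute)
  finally have "(\<Sum>j<Suc r. d j * s' j) dvd d i" if "i < Suc r" for i
    using that s by (metis dvd_trans g_def gcd_dvd1 gcd_dvd2 less_antisym)
  then show ?case by blast
qed simp

section \<open>Centres and commutants\<close>

lemma (in group) centreD:
  assumes "z \<in> centre G"
  shows "z \<in> carrier G" "g \<in> carrier G \<Longrightarrow> z \<otimes> g = g \<otimes> z"
  using assms by (auto simp: centre_def)

lemma (in group) commutant_subgroup:
  assumes "x \<in> carrier G"
  shows "subgroup {g \<in> carrier G. x \<otimes> g = g \<otimes> x} G"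
proof
  fix g assume "g \<in> {g \<in> carrier G. x \<otimes> g = g \<otimes> x}"
  then have g: "g \<in> carrier G" "x \<otimes> g = g \<otimes> x" by auto
  have "x \<otimes> inv g = inv g \<otimes> (g \<otimes> x) \<otimes> inv g" using assms g(1) by (simp add: m_assoc[symmetric])
  also have "\<dots> = inv g \<otimes> (x \<otimes> g) \<otimes> inv g" using g(2) by simp
  also have "\<dots> = inv g \<otimes> x" using assms g(1) by (simp add: m_assoc)
  finally show "inv g \<in> {g \<in> carrier G. x \<otimes> g = g \<otimes> x}" using g(1) by simp
next
  fix g h assume "g \<in> {g \<in> carrier G. x \<otimes> g = g \<otimes> x}" "h \<in> {g \<in> carrier G. x \<otimes> g = g \<otimes> x}"
  then show "g \<otimes> h \<in> {g \<in> carrier G. x \<otimes> g = g \<otimes> x}"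
    using assms by simp (metis m_assoc)
qed (use assms in auto)

lemma (in group) commute_generate:
  assumes "x \<in> carrier G" "S \<subseteq> carrier G" "\<And>s. s \<in> S \<Longrightarrow> x \<otimes> s = s \<otimes> x"
    and "g \<in> generate G S"
  shows "x \<otimes> g = g \<otimes> x"
  using generate_subgroup_incl[OF _ commutant_subgroup[OF assms(1)], of S] assms(2-4) by auto

lemma (in group) centre_subgroup: "subgroup (centre G) G"
proof -
  have "centre G = (\<Inter>x \<in> carrier G. {g \<in> carrier G. x \<otimes> g = g \<otimes> x})"
    by (auto simp: centre_def)
  then show ?thesis using commutant_subgroup by (auto intro!: subgroups_Inter)
qed

lemma (in group) centre_int_pow: "z \<in> centre G \<Longrightarrow> z [^] (k::int) \<in> centre G"
  using subgroup_int_pow_closed[OF centre_subgroup] by blast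

lemma (in group) centre_nat_pow: "z \<in> centre G \<Longrightarrow> z [^] (k::nat) \<in> centre G"
  using centre_int_pow[of z "int k"] by (simp add: int_pow_int)

lemma (in group) central_rearrange:
  assumes "z \<in> centre G" "a \<in> carrier G" "b \<in> carrier G"
  shows "a \<otimes> z [^] (i::int) \<otimes> (b \<otimes> z [^] (j::int)) = a \<otimes> b \<otimes> z [^] (i + j)"
proof -
  have "z [^] i \<otimes> b = b \<otimes> z [^] i" using centre_int_pow[OF assms(1)] centreD assms(3) by blast
  then show ?thesis using assms centreD(1)[OF assms(1)]
    by (metis int_pow_closed int_pow_mult m_assoc m_closed)
qed

section \<open>Exponent sums\<close>

fun letter_exponent :: "'c letter \<Rightarrow> nat \<Rightarrow> int" where
  "letter_exponent (Coeff c) i = 0"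
| "letter_exponent (Var j) i = of_bool (j = i)"
| "letter_exponent (VarInv j) i = - of_bool (j = i)"

text \<open>For a word without coefficients, these are its coordinates in the abelianisation of the
  free group.\<close>

definition exponent_sum :: "'c word \<Rightarrow> nat \<Rightarrow> int" where
  "exponent_sum w i = (\<Sum>l\<leftarrow>w. letter_exponent l i)"

lemma exponent_sum_simps [simp]:
  "exponent_sum [] i = 0"
  "exponent_sum (l # w) i = letter_exponent l i + exponent_sum w i"
  by (simp_all add: exponent_sum_def)

lemma free_words_induct [consumes 1, case_names Nil Var VarInv]:
  assumes "w \<in> free_product_words {} r"
    and "P []"
    and "\<And>i w. i < r \<Longrightarrow> w \<in> free_product_words {} r \<Longrightarrow> P w \<Longrightarrow> P (Var i # w)"
    and "\<And>i w. i < r \<Longrightarrow> w \<in> free_product_words {} r \<Longrightarrow> P w \<Longrightarrow> P (VarInv i # w)"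
  shows "P w"
proof -
  have "w \<in> lists (Coeff ` {} \<union> Var ` {..<r} \<union> VarInv ` {..<r})"
    using assms(1) by (simp add: free_product_words_def)
  then show ?thesis
    by (induction w) (use assms(2-4) in \<open>auto simp: free_product_words_def\<close>)
qed

lemma exponent_sum_telescope:
  fixes t :: "nat \<Rightarrow> int"
  assumes "i < r"
  shows "(\<Sum>j<r. (of_bool (i = j) + f j) * t j) = t i + (\<Sum>j<r. f j * t j)"
    and "(\<Sum>j<r. (f j - of_bool (i = j)) * t j) = - t i + (\<Sum>j<r. f j * t j)"
proof -
  have "(\<Sum>j<r. of_bool (i = j) * t j) = (\<Sum>j<r. if j = i then t j else 0)"
    by (rule sum.cong) auto
  then have "(\<Sum>j<r. of_bool (i = j) * t j) = t i" using assms by simp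
  then show "(\<Sum>j<r. (of_bool (i = j) + f j) * t j) = t i + (\<Sum>j<r. f j * t j)"
    and "(\<Sum>j<r. (f j - of_bool (i = j)) * t j) = - t i + (\<Sum>j<r. f j * t j)"
    by (simp_all add: distrib_right left_diff_distrib sum.distrib sum_subtractf)
qed

text \<open>Central factors move to the end of the product, so only the signed number of occurrences
  of each variable matters.\<close>

lemma (in group) word_value_central_shift:
  assumes z: "z \<in> centre G" and h: "\<And>i. i < r \<Longrightarrow> h i \<in> carrier G"
    and w: "w \<in> free_product_words {} r"
  shows "word_value G (\<lambda>i. h i \<otimes> z [^] (t i :: int)) w =
    word_value G h w \<otimes> z [^] (\<Sum>i<r. exponent_sum w i * t i)"
  using w
proof (induction rule: free_words_induct)
  case (Var i w)
  have "word_value G h w \<in> carrier G"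
    by (rule word_value_closed[OF is_group _ subgroup_self _ Var(2)]) (use h in auto)
  then show ?case using Var h[of i] central_rearrange[OF z]
    by (simp add: exponent_sum_telescope)
next
  case (VarInv i w)
  have cl: "word_value G h w \<in> carrier G"
    by (rule word_value_closed[OF is_group _ subgroup_self _ VarInv(2)]) (use h in auto)
  have hi: "h i \<in> carrier G" and zc: "z \<in> carrier G" using VarInv h centreD[OF z] by auto
  have "inv (h i \<otimes> z [^] t i) = inv (h i) \<otimes> z [^] (- t i)"
    using centreD(2)[OF centre_int_pow[OF z]] hi zc by (simp add: inv_mult_group int_pow_neg)
      (metis centreD(2) centre_int_pow int_pow_neg inv_closed z)
  then show ?case using VarInv hi cl central_rearrange[OF z]
    by (simp add: exponent_sum_telescope)
qed (simp_all)

lemma word_value_cong: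
  assumes "\<And>i. i < r \<Longrightarrow> x i = y i" "w \<in> free_product_words C r"
  shows "word_value G x w = word_value G y w"
proof -
  have "w \<in> lists (Coeff ` C \<union> Var ` {..<r} \<union> VarInv ` {..<r})"
    using assms(2) by (simp add: free_product_words_def)
  then show ?thesis by (induction w) (auto simp: assms(1))
qed

section \<open>Adjoining central roots\<close>

text \<open>The empty combination in \<open>lin\<close> puts the zero vector into
  \<open>\<Lambda>\<close>, and \<open>cover\<close> then makes m positive. The verbal closedness of
  the diagonal rests on \<open>cover\<close>.\<close>

locale root_extension = group H for H :: "'a monoid" (structure) +
  fixes z :: 'a and n m :: nat and \<Lambda> :: "(nat \<Rightarrow> int) set"
  assumes z: "z \<in> centre H" and n: "n > 0"
    and lin: "\<And>(r :: nat) c E. (\<And>i. i < r \<Longrightarrow> E i \<in> \<Lambda>) \<Longrightarrow> (\<lambda>l. \<Sum>i<r. c i * E i l) \<in> \<Lambda>"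
    and supp: "\<And>E l. E \<in> \<Lambda> \<Longrightarrow> l \<ge> m \<Longrightarrow> E l = 0"
    and cover: "\<And>E. E \<in> \<Lambda> \<Longrightarrow> \<exists>l<m. int n dvd E l"
begin

text \<open>A pair \<open>(g, e)\<close> with \<open>0 \<le> e < n\<close> encodes \<open>g \<zeta>\<^sup>e\<close>, where \<open>\<zeta>\<close> is the adjoined root of \<open>z\<close>.\<close>

definition tup :: "(nat \<Rightarrow> 'a) \<Rightarrow> (nat \<Rightarrow> int) \<Rightarrow> nat \<Rightarrow> 'a \<times> int" where
  "tup h E = (\<lambda>l. (h l \<otimes> z [^] (E l div int n), E l mod int n))"

definition base :: "(nat \<Rightarrow> 'a) set" where
  "base = {h. \<forall>l. h l \<in> carrier H \<and> (l \<ge> m \<longrightarrow> h l = \<one>)}"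

text \<open>Tuples over H with \<open>\<zeta>\<close> adjoined, trivial from coordinate m on. The
  power of z in the product is the carry that arises from replacing the n-th power of
  \<open>\<zeta>\<close> by z.\<close>

definition ext :: "(nat \<Rightarrow> 'a \<times> int) monoid" where
  "ext = \<lparr>carrier = {tup h E | h E. h \<in> base \<and> E \<in> \<Lambda>},
    monoid.mult = (\<lambda>f g l. (fst (f l) \<otimes> fst (g l) \<otimes> z [^] ((snd (f l) + snd (g l)) div int n),
      (snd (f l) + snd (g l)) mod int n)),
    one = (\<lambda>l. (\<one>, 0))\<rparr>"

definition diag :: "'a \<Rightarrow> nat \<Rightarrow> 'a \<times> int" where
  "diag g = tup (\<lambda>l. if l < m then g else \<one>) (\<lambda>l. 0)"

lemma zc [simp]: "z \<in> carrier H" using centreD[OF z] by simp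

lemma lat_zero: "(\<lambda>l. 0) \<in> \<Lambda>" using lin[of 0] by simp
lemma lat_add: "E \<in> \<Lambda> \<Longrightarrow> E' \<in> \<Lambda> \<Longrightarrow> (\<lambda>l. E l + E' l) \<in> \<Lambda>"
  using lin[of 2 "\<lambda>i. if i = 0 then E else E'" "\<lambda>i. 1"] by (simp add: numeral_2_eq_2)
lemma lat_minus: "E \<in> \<Lambda> \<Longrightarrow> (\<lambda>l. - E l) \<in> \<Lambda>"
  using lin[of 1 "\<lambda>i. E" "\<lambda>i. - 1"] by simp

text \<open>The quotients of \<open>E l\<close> and \<open>E' l\<close> by n, together with the
  carry from their residues, add up to the quotient of the sum. Hence calculations can use unreduced
  exponents.\<close>

lemma tup_mult:
  assumes "\<And>l. h l \<in> carrier H" "\<And>l. h' l \<in> carrier H"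
  shows "tup h E \<otimes>\<^bsub>ext\<^esub> tup h' E' = tup (\<lambda>l. h l \<otimes> h' l) (\<lambda>l. E l + E' l)"
proof
  fix l
  show "(tup h E \<otimes>\<^bsub>ext\<^esub> tup h' E') l = tup (\<lambda>l. h l \<otimes> h' l) (\<lambda>l. E l + E' l) l"
    using assms central_rearrange[OF z] int_pow_mult[OF zc]
    by (simp add: ext_def tup_def m_assoc div_add1_eq[of "E l" "E' l"] mod_add_eq)
      (metis (no_types, opaque_lifting) int_pow_closed m_assoc m_closed zc)
qed

lemma tup_one: "tup (\<lambda>l. \<one>) (\<lambda>l. 0) = \<one>\<^bsub>ext\<^esub>"
  by (simp add: ext_def tup_def)

lemma tup_closed: "h \<in> base \<Longrightarrow> E \<in> \<Lambda> \<Longrightarrow> tup h E \<in> carrier ext"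
  by (auto simp: ext_def)

lemma baseD: "h \<in> base \<Longrightarrow> h l \<in> carrier H"
  by (simp add: base_def)

lemma base_mult: "h \<in> base \<Longrightarrow> h' \<in> base \<Longrightarrow> (\<lambda>l. h l \<otimes> h' l) \<in> base"
  by (auto simp: base_def)

lemma ext_carrierE:
  assumes "x \<in> carrier ext"
  obtains h E where "x = tup h E" "h \<in> base" "E \<in> \<Lambda>"
  using assms by (auto simp: ext_def)

lemma tup_inv_left:
  assumes "\<And>l. h l \<in> carrier H"
  shows "tup (\<lambda>l. inv (h l)) (\<lambda>l. - E l) \<otimes>\<^bsub>ext\<^esub> tup h E = \<one>\<^bsub>ext\<^esub>"
  using assms by (simp add: tup_mult tup_one)

lemma group_ext: "group ext"
proof (rule groupI)
  fix x y assume "x \<in> carrier ext" "y \<in> carrier ext"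
  then show "x \<otimes>\<^bsub>ext\<^esub> y \<in> carrier ext"
    by (elim ext_carrierE) (simp add: tup_mult baseD base_mult lat_add tup_closed)
next
  fix x y w assume "x \<in> carrier ext" "y \<in> carrier ext" "w \<in> carrier ext"
  then show "x \<otimes>\<^bsub>ext\<^esub> y \<otimes>\<^bsub>ext\<^esub> w = x \<otimes>\<^bsub>ext\<^esub> (y \<otimes>\<^bsub>ext\<^esub> w)"
    by (elim ext_carrierE) (simp add: tup_mult baseD m_assoc add.assoc)
next
  have "(\<lambda>l. \<one>) \<in> base" by (simp add: base_def)
  then show "\<one>\<^bsub>ext\<^esub> \<in> carrier ext" using tup_closed lat_zero by (metis tup_one)
next
  fix x assume "x \<in> carrier ext"
  then obtain h E where x: "x = tup h E" "h \<in> base" "E \<in> \<Lambda>" by (rule ext_carrierE)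
  then show "\<one>\<^bsub>ext\<^esub> \<otimes>\<^bsub>ext\<^esub> x = x"
    by (simp add: tup_one[symmetric] tup_mult baseD)
  have "(\<lambda>l. inv (h l)) \<in> base" using x(2) by (simp add: base_def)
  then show "\<exists>y\<in>carrier ext. y \<otimes>\<^bsub>ext\<^esub> x = \<one>\<^bsub>ext\<^esub>"
    using x baseD tup_inv_left tup_closed lat_minus by blast
qed

sublocale ext: group ext by (rule group_ext)

lemma tup_inv:
  assumes "h \<in> base" "E \<in> \<Lambda>"
  shows "inv\<^bsub>ext\<^esub> tup h E = tup (\<lambda>l. inv (h l)) (\<lambda>l. - E l)"
proof (rule ext.inv_equality)
  show "tup (\<lambda>l. inv (h l)) (\<lambda>l. - E l) \<otimes>\<^bsub>ext\<^esub> tup h E = \<one>\<^bsub>ext\<^esub>"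
    using assms baseD tup_inv_left by blast
  have "(\<lambda>l. inv (h l)) \<in> base" using assms by (simp add: base_def)
  then show "tup (\<lambda>l. inv (h l)) (\<lambda>l. - E l) \<in> carrier ext"
    using assms lat_minus tup_closed by blast
qed (use assms tup_closed in auto)

text \<open>The powers of \<open>\<zeta>\<close> are central, so they enter only through exponent
  sums. As w has no coefficients, \<open>map_letter f\<close> merely changes its type.\<close>

lemma word_value_tup:
  assumes h: "\<And>i. i < r \<Longrightarrow> h i \<in> base" and E: "\<And>i. i < r \<Longrightarrow> E i \<in> \<Lambda>"
    and w: "w \<in> free_product_words {} r"
  shows "word_value ext (\<lambda>i. tup (h i) (E i)) (map (map_letter f) w) =
    tup (\<lambda>l. word_value H (\<lambda>i. h i l) w) (\<lambda>l. \<Sum>i<r. exponent_sum w i * E i l)"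
proof -
  have cl: "word_value H (\<lambda>i. h i l) v \<in> carrier H" if "v \<in> free_product_words {} r" for v l
    by (rule word_value_closed[OF is_group _ subgroup_self _ that]) (use h in \<open>auto simp: baseD\<close>)
  show ?thesis
    using w
  proof (induction rule: free_words_induct)
    case Nil
    then show ?case by (simp add: tup_one)
  next
    case (Var i w)
    then show ?case using cl h by (simp add: tup_mult baseD exponent_sum_telescope)
  next
    case (VarInv i w)
    then show ?case using cl h E
      by (simp add: tup_mult baseD tup_inv exponent_sum_telescope)
  qed
qed

lemma diag_base: "g \<in> carrier H \<Longrightarrow> (\<lambda>l. if l < m then g else \<one>) \<in> base"
  by (auto simp: base_def)

lemma diag_hom: "diag \<in> hom H ext"
proof (rule homI)
  fix g assume "g \<in> carrier H"
  then show "diag g \<in> carrier ext" unfolding diag_def by (intro tup_closed diag_base lat_zero)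
next
  fix g g' assume "g \<in> carrier H" "g' \<in> carrier H"
  then show "diag (g \<otimes> g') = diag g \<otimes>\<^bsub>ext\<^esub> diag g'"
    by (simp add: diag_def tup_mult if_distrib cong: if_cong)
qed

lemma diag_inj: "inj_on diag (carrier H)"
proof (rule inj_onI)
  fix g g' assume g: "g \<in> carrier H" "g' \<in> carrier H" "diag g = diag g'"
  \<comment> \<open>Applied to the zero vector, \<open>cover\<close> yields a coordinate below m,
    where \<open>diag g\<close> shows g.\<close>
  obtain l where "l < m" using cover[OF lat_zero] by blast
  moreover have "fst (diag g l) = fst (diag g' l)" using g(3) by simp
  ultimately show "g = g'" using g(1,2) by (simp add: diag_def tup_def)
qed

text \<open>
  If the exponent sums of \<open>w\<close> have greatest common divisor \<open>d\<close>, the value of \<open>w\<close> at a tuple of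
  elements of the extension is its value in the \<open>H\<close>-components times the \<open>d\<close>-th power of one
  central element. Some coordinate of this element lies in \<open>H\<close>, and there it can be absorbed
  into the arguments.
\<close>

lemma diag_verbally_closed: "verbally_closed ext (diag ` carrier H)"
proof (rule verbally_closedI)
  interpret diag: group_hom H ext diag
    using diag_hom by (simp add: group_hom_def group_hom_axioms_def is_group group_ext)
  show "subgroup (diag ` carrier H) ext" by (rule diag.img_is_subgroup)
  fix r w g' x
  assume w: "w \<in> free_product_words {} r" and g': "g' \<in> diag ` carrier H"
    and x: "x \<in> {..<r} \<rightarrow> carrier ext" and xw: "word_value ext x w = g'"
  obtain g where g: "g \<in> carrier H" "g' = diag g" using g' by blast
  \<comment> \<open>The same word with coefficient type that of H; there are no coefficients to
    translate.\<close>
  define v :: "'a word" where "v = map (map_letter (\<lambda>_. \<one>)) w"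
  have v: "v \<in> free_product_words {} r"
    unfolding v_def by (rule map_word_free_product[OF _ w]) simp
  have wv: "w = map (map_letter diag) v"
    unfolding v_def by (rule map_word_id[OF _ w, symmetric]) simp
  have "\<forall>i. \<exists>h E. i < r \<longrightarrow> x i = tup h E \<and> h \<in> base \<and> E \<in> \<Lambda>"
    using x ext_carrierE by (metis Pi_mem lessThan_iff)
  then obtain h E where hE: "\<And>i. i < r \<Longrightarrow> x i = tup (h i) (E i)"
    "\<And>i. i < r \<Longrightarrow> h i \<in> base" "\<And>i. i < r \<Longrightarrow> E i \<in> \<Lambda>" by metis
  obtain s where s: "\<And>i. i < r \<Longrightarrow> (\<Sum>j<r. exponent_sum v j * s j) dvd exponent_sum v i"
    using bezout_sum[of r "exponent_sum v"] by blast
  define d where "d = (\<Sum>j<r. exponent_sum v j * s j)"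
  have "\<forall>i. \<exists>c. i < r \<longrightarrow> exponent_sum v i = d * c" using s d_def by (metis dvdE)
  then obtain c where c: "\<And>i. i < r \<Longrightarrow> exponent_sum v i = d * c i" by metis
  \<comment> \<open>The exponents of \<open>\<zeta>\<close> in the value of w form d times this one
    lattice vector, so a single coordinate divisible by n suffices.\<close>
  define F where "F l = (\<Sum>i<r. c i * E i l)" for l
  have "F \<in> \<Lambda>" unfolding F_def using lin[of r E c] hE(3) by simp
  then obtain l k where l: "l < m" and k: "F l = int n * k" using cover by (metis dvdE)
  have "word_value ext x w = word_value ext (\<lambda>i. tup (h i) (E i)) w"
    by (rule word_value_cong[OF hE(1) w])
  also have "\<dots> = tup (\<lambda>l. word_value H (\<lambda>i. h i l) v) (\<lambda>l. \<Sum>i<r. exponent_sum v i * E i l)"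
    unfolding wv by (rule word_value_tup[OF hE(2,3) v])
  also have "(\<lambda>l. \<Sum>i<r. exponent_sum v i * E i l) = (\<lambda>l. d * F l)"
    using c by (simp add: F_def sum_distrib_left mult.assoc)
  finally have eq: "tup (\<lambda>l. word_value H (\<lambda>i. h i l) v) (\<lambda>l. d * F l) = diag g" using xw g by simp
  have val: "word_value H (\<lambda>i. h i l) v \<otimes> z [^] (d * k) = g"
    using fun_cong[OF eq, of l] k l n g by (simp add: tup_def diag_def mult.left_commute)
  \<comment> \<open>At coordinate l the excess factor is \<open>z [^] (d * k)\<close>. Because d is
    the combination of the exponent sums with coefficients s, these shifts contribute exactly this
    power.\<close>
  define y where "y i = h i l \<otimes> z [^] (s i * k)" for i
  have y: "y \<in> {..<r} \<rightarrow> carrier H" using hE(2) by (auto simp: y_def baseD)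
  have "word_value H y v = word_value H (\<lambda>i. h i l) v \<otimes> z [^] (\<Sum>i<r. exponent_sum v i * (s i * k))"
    unfolding y_def by (rule word_value_central_shift[OF z _ v]) (use hE(2) baseD in blast)
  also have "(\<Sum>i<r. exponent_sum v i * (s i * k)) = d * k"
    by (simp add: d_def sum_distrib_right mult.assoc)
  finally have "word_value H y v = g" using val by simp
  then have "word_value ext (\<lambda>i. diag (y i)) w = g'"
    using word_value_hom[OF is_group group_ext diag_hom _ y _ v, of "\<lambda>i. diag (y i)"] g wv by simp
  then show "\<exists>x \<in> {..<r} \<rightarrow> diag ` carrier H. word_value ext x w = g'"
    using y by (intro bexI[of _ "\<lambda>i. diag (y i)"]) auto
qed

end

section \<open>Solving the system in the verbally closed subgroup\<close>

primrec gprod :: "('a, 'b) monoid_scheme \<Rightarrow> (nat \<Rightarrow> 'a) \<Rightarrow> nat \<Rightarrow> 'a" where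
  "gprod G f 0 = \<one>\<^bsub>G\<^esub>"
| "gprod G f (Suc m) = gprod G f m \<otimes>\<^bsub>G\<^esub> f m"

lemma gprod_cong: "(\<And>i. i < m \<Longrightarrow> f i = g i) \<Longrightarrow> gprod G f m = gprod G g m"
  by (induction m) auto

definition power_word :: "(nat \<Rightarrow> nat) \<Rightarrow> (nat \<Rightarrow> nat) \<Rightarrow> nat \<Rightarrow> 'c word" where
  "power_word v b m = concat (map (\<lambda>i. replicate (b i) (Var (v i))) [0..<m])"

lemma map_power_word [simp]: "map (map_letter f) (power_word v b m) = power_word v b m"
  by (simp add: power_word_def map_concat comp_def)

lemma power_word_closed:
  "(\<And>i. i < m \<Longrightarrow> v i < r) \<Longrightarrow> power_word v b m \<in> free_product_words C r"
  by (auto simp: power_word_def free_product_words_def in_lists_conv_set)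

context group
begin

lemma gprod_closed [simp]:
  "(\<And>i. i < m \<Longrightarrow> f i \<in> carrier G) \<Longrightarrow> gprod G f m \<in> carrier G"
  by (induction m) auto

lemma word_value_letters_closed:
  "(\<And>l. l \<in> set w \<Longrightarrow> letter_value G x l \<in> carrier G) \<Longrightarrow> word_value G x w \<in> carrier G"
  by (induction w) auto

lemma word_value_append:
  assumes "\<And>l. l \<in> set u \<union> set v \<Longrightarrow> letter_value G x l \<in> carrier G"
  shows "word_value G x (u @ v) = word_value G x u \<otimes> word_value G x v"
  using assms
proof (induction u)
  case (Cons l u)
  then show ?case by (simp add: word_value_letters_closed m_assoc)
qed (simp add: word_value_letters_closed)

lemma word_value_replicate:
  "letter_value G x l \<in> carrier G \<Longrightarrow> word_value G x (replicate b l) = letter_value G x l [^] b"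
  by (induction b) (simp_all add: nat_pow_Suc2[symmetric] del: nat_pow_Suc)

lemma word_value_power_word:
  assumes "\<And>i. i < m \<Longrightarrow> x (v i) \<in> carrier G"
  shows "word_value G x (power_word v b m) = gprod G (\<lambda>i. x (v i) [^] b i) m"
  using assms
proof (induction m)
  case (Suc m)
  have "word_value G x (power_word v b (Suc m)) =
      word_value G x (power_word v b m) \<otimes> word_value G x (replicate (b m) (Var (v m)))"
    unfolding power_word_def by (simp, rule word_value_append) (use Suc.prems in auto)
  then show ?case using Suc by (simp add: word_value_replicate)
qed (simp add: power_word_def)

lemma mult_inv_eq_one_iff:
  assumes "a \<in> carrier G" "b \<in> carrier G"
  shows "a \<otimes> inv b = \<one> \<longleftrightarrow> a = b"
proof
  assume "a \<otimes> inv b = \<one>"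
  then have "inv (inv b) = a" using assms by (intro inv_equality) simp_all
  then show "a = b" using assms by simp
qed (use assms in simp)

text \<open>The bracketing is the one in which \<open>word_value\<close> evaluates a four-letter
  commutator word.\<close>

lemma commutator_eq_one_iff:
  assumes "a \<in> carrier G" "b \<in> carrier G"
  shows "a \<otimes> (b \<otimes> (inv a \<otimes> inv b)) = \<one> \<longleftrightarrow> a \<otimes> b = b \<otimes> a"
proof -
  have "a \<otimes> (b \<otimes> (inv a \<otimes> inv b)) = a \<otimes> b \<otimes> inv (b \<otimes> a)"
    using assms by (simp add: m_assoc inv_mult_group)
  then show ?thesis using assms by (simp add: mult_inv_eq_one_iff)
qed

text \<open>Leaving the letter l open covers two kinds of equations at once: those with a
  coefficient on the right (n = 1) and those with the n-th power of an unknown.\<close>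

lemma word_value_power_equation:
  assumes "\<And>i. i < m \<Longrightarrow> x (v i) \<in> carrier G" "g \<in> carrier G" "letter_value G x l = inv g"
  shows "word_value G x (power_word v b m @ replicate n l) = \<one> \<longleftrightarrow>
    gprod G (\<lambda>i. x (v i) [^] b i) m = g [^] n"
proof -
  have "word_value G x (power_word v b m @ replicate n l) =
      word_value G x (power_word v b m) \<otimes> word_value G x (replicate n l)"
    by (rule word_value_append) (use assms in \<open>auto simp: power_word_def\<close>)
  also have "\<dots> = gprod G (\<lambda>i. x (v i) [^] b i) m \<otimes> inv (g [^] n)"
    using assms by (simp add: word_value_power_word word_value_replicate nat_pow_inv)
  also have "\<dots> = \<one> \<longleftrightarrow> gprod G (\<lambda>i. x (v i) [^] b i) m = g [^] n"
    by (rule mult_inv_eq_one_iff) (simp_all add: assms)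
  finally show ?thesis .
qed

end

text \<open>The translated system is solved in the image of H by algebraic closedness, and the
  solution is pulled back along the injective \<open>\<phi>\<close>.\<close>

lemma strongly_verbally_closed_solve:
  fixes H :: "'a monoid" and G :: "'g monoid"
  assumes H: "group H" "strongly_verbally_closed H"
    and G: "group G" and \<phi>: "\<phi> \<in> hom H G" "inj_on \<phi> (carrier H)"
    and vc: "verbally_closed G (\<phi> ` carrier H)"
    and W: "finite W" "W \<subseteq> free_product_words (carrier H) r"
    and y: "y \<in> {..<r} \<rightarrow> carrier G"
    and yw: "\<And>w. w \<in> W \<Longrightarrow> word_value G y (map (map_letter \<phi>) w) = \<one>\<^bsub>G\<^esub>"
  obtains x where "x \<in> {..<r} \<rightarrow> carrier H" "\<And>w. w \<in> W \<Longrightarrow> word_value H x w = \<one>\<^bsub>H\<^esub>"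
proof -
  interpret \<phi>: group_hom H G \<phi>
    using H G \<phi> by (simp add: group_hom_def group_hom_axioms_def)
  have ac: "algebraically_closed G (\<phi> ` carrier H)"
    by (rule strongly_verbally_closedD[OF H G \<phi> vc])
  have W': "map (map_letter \<phi>) ` W \<subseteq> free_product_words (\<phi> ` carrier H) r"
    using W(2) map_word_free_product[of \<phi> "carrier H"] by blast
  obtain x where x: "x \<in> {..<r} \<rightarrow> \<phi> ` carrier H"
    "\<And>w. w \<in> map (map_letter \<phi>) ` W \<Longrightarrow> word_value G x w = \<one>\<^bsub>G\<^esub>"
    by (rule algebraically_closedD[OF ac finite_imageI[OF W(1)] W' y]) (use yw in blast)+
  define x' where "x' i = inv_into (carrier H) \<phi> (x i)" for i
  have x': "x' \<in> {..<r} \<rightarrow> carrier H" using x(1) by (auto simp: x'_def Pi_iff intro: inv_into_into)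
  have xx: "x i = \<phi> (x' i)" if "i < r" for i
    using x(1) that by (auto simp: x'_def Pi_iff f_inv_into_f)
  have "word_value H x' w = \<one>\<^bsub>H\<^esub>" if w: "w \<in> W" for w
  proof -
    have w': "w \<in> free_product_words (carrier H) r" using w W(2) by blast
    have "\<phi> (word_value H x' w) = word_value G x (map (map_letter \<phi>) w)"
      using word_value_hom[OF H(1) G \<phi>(1) subset_refl x' xx w'] by simp
    also have "\<dots> = \<phi> \<one>\<^bsub>H\<^esub>" using x(2) w by simp
    finally show ?thesis
      using \<phi>(2) word_value_closed[OF H(1) subset_refl group.subgroup_self[OF H(1)] x' w']
      by (auto simp: inj_on_def)
  qed
  then show thesis using x' that by blast
qed

section \<open>The system of equations in the root extension and its solution in H\<close>

context root_extension
begin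

lemma tup_pow:
  assumes "h \<in> base"
  shows "tup h E [^]\<^bsub>ext\<^esub> (b :: nat) = tup (\<lambda>l. h l [^] b) (\<lambda>l. int b * E l)"
proof (induction b)
  case 0
  then show ?case by (simp add: tup_one)
next
  case (Suc b)
  then show ?case using assms by (simp add: tup_mult baseD algebra_simps)
qed

lemma gprod_tup:
  assumes "\<And>i. h i \<in> base"
  shows "gprod ext (\<lambda>i. tup (h i) (\<lambda>l. 0)) k = tup (\<lambda>l. gprod H (\<lambda>i. h i l) k) (\<lambda>l. 0)"
proof (induction k)
  case (Suc k)
  then show ?case using assms by (simp add: tup_mult baseD)
qed (simp add: tup_one)

text \<open>In the extension, take for \<open>t i j\<close> the tuple with \<open>hs j\<close> at
  coordinate i and \<open>\<one>\<close> elsewhere, and for \<open>c k\<close> the tuple of powers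
  of \<open>\<zeta>\<close> with exponents \<open>a k i\<close>. At coordinate i both sides of the
  power equation are then \<open>z [^] a k i\<close>. Closedness of the diagonal carries solvability
  over to H.\<close>

lemma solve_system:
  fixes q s :: nat and hs :: "nat \<Rightarrow> 'a" and a :: "nat \<Rightarrow> nat \<Rightarrow> nat"
  assumes svc: "strongly_verbally_closed H"
    and hs: "\<And>j. j < q \<Longrightarrow> hs j \<in> carrier H" "0 < q" "hs 0 [^] n = z"
    and a: "\<And>k. k < s \<Longrightarrow> (\<lambda>i. int (a k i)) \<in> \<Lambda>"
  obtains t c where "\<And>i j. i < m \<Longrightarrow> j < q \<Longrightarrow> t i j \<in> carrier H"
    and "\<And>k. k < s \<Longrightarrow> c k \<in> carrier H"
    and "\<And>i i' j j'. i < m \<Longrightarrow> i' < m \<Longrightarrow> i \<noteq> i' \<Longrightarrow> j < q \<Longrightarrow> j' < q \<Longrightarrow>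
      t i j \<otimes> t i' j' = t i' j' \<otimes> t i j"
    and "\<And>j. j < q \<Longrightarrow> gprod H (\<lambda>i. t i j) m = hs j"
    and "\<And>k j. k < s \<Longrightarrow> j < q \<Longrightarrow> c k \<otimes> hs j = hs j \<otimes> c k"
    and "\<And>k. k < s \<Longrightarrow> gprod H (\<lambda>i. t i 0 [^] (n * a k i)) m = c k [^] n"
proof -
  \<comment> \<open>The first \<open>m * q\<close> variables stand for the \<open>t i j\<close>, in
    blocks of length q, and the last s for the \<open>c k\<close>.\<close>
  define r where "r = m * q + s"
  define v where "v i j = i * q + j" for i j
  define u where "u k = m * q + k" for k
  have v: "v i j < m * q" "v i j < r" "v i j div q = i" "v i j mod q = j"
    if "i < m" "j < q" for i j
  proof -
    have "v i j < Suc i * q" using that by (simp add: v_def)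
    also have "\<dots> \<le> m * q" using that by (intro mult_le_mono1) simp
    finally show "v i j < m * q" .
    then show "v i j < r" by (simp add: r_def)
    show "v i j div q = i" "v i j mod q = j" using that by (simp_all add: v_def)
  qed
  have u: "u k < r" "\<not> u k < m * q" "u k - m * q = k" if "k < s" for k
    using that by (auto simp: u_def r_def)
  \<comment> \<open>In order: commuting of factors with different i, the products
    \<open>hs j\<close>, commuting of \<open>c k\<close> with \<open>hs j\<close>, and the power
    equations.\<close>
  define W :: "'a word set" where "W =
    (\<lambda>(i, j, i', j'). [Var (v i j), Var (v i' j'), VarInv (v i j), VarInv (v i' j')]) `
      {(i, j, i', j'). i < m \<and> i' < m \<and> i \<noteq> i' \<and> j < q \<and> j' < q} \<union>
    (\<lambda>j. power_word (\<lambda>i. v i j) (\<lambda>i. 1) m @ replicate 1 (Coeff (inv (hs j)))) ` {..<q} \<union>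
    (\<lambda>(k, j). [Var (u k), Coeff (hs j), VarInv (u k), Coeff (inv (hs j))]) ` ({..<s} \<times> {..<q}) \<union>
    (\<lambda>k. power_word (\<lambda>i. v i 0) (\<lambda>i. n * a k i) m @ replicate n (VarInv (u k))) ` {..<s}"
  have W: "finite W"
  proof -
    have "{(i, j, i', j'). i < m \<and> i' < m \<and> i \<noteq> i' \<and> j < q \<and> j' < q} \<subseteq>
        {..<m} \<times> {..<q} \<times> {..<m} \<times> {..<q}" by auto
    then have "finite {(i, j, i', j'). i < m \<and> i' < m \<and> i \<noteq> i' \<and> j < q \<and> j' < q}"
      by (rule finite_subset) simp
    then show ?thesis by (simp add: W_def)
  qed
  have append: "p @ p' \<in> free_product_words (carrier H) r"
    if "p \<in> free_product_words (carrier H) r" "p' \<in> free_product_words (carrier H) r" for p p'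
    using that by (simp add: free_product_words_def)
  have W_cases [consumes 1, case_names 1 2 3 4]: thesis if "w \<in> W"
    and "\<And>i j i' j'. i < m \<Longrightarrow> i' < m \<Longrightarrow> i \<noteq> i' \<Longrightarrow> j < q \<Longrightarrow> j' < q \<Longrightarrow>
      w = [Var (v i j), Var (v i' j'), VarInv (v i j), VarInv (v i' j')] \<Longrightarrow> thesis"
    and "\<And>j. j < q \<Longrightarrow>
      w = power_word (\<lambda>i. v i j) (\<lambda>i. 1) m @ replicate 1 (Coeff (inv (hs j))) \<Longrightarrow> thesis"
    and "\<And>k j. k < s \<Longrightarrow> j < q \<Longrightarrow>
      w = [Var (u k), Coeff (hs j), VarInv (u k), Coeff (inv (hs j))] \<Longrightarrow> thesis"
    and "\<And>k. k < s \<Longrightarrow>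
      w = power_word (\<lambda>i. v i 0) (\<lambda>i. n * a k i) m @ replicate n (VarInv (u k)) \<Longrightarrow> thesis"
    for w thesis
    using that(1) unfolding W_def by (elim UnE imageE) (use that(2-5) in auto)
  have Wr: "W \<subseteq> free_product_words (carrier H) r"
  proof
    fix w assume "w \<in> W"
    then show "w \<in> free_product_words (carrier H) r"
    proof (cases rule: W_cases)
      case (1 i j i' j')
      then show ?thesis using v(2) by (simp add: free_product_words_def)
    next
      case (2 j)
      then have "replicate 1 (Coeff (inv (hs j))) \<in> free_product_words (carrier H) r"
        using hs(1) by (simp add: free_product_words_def)
      then show ?thesis unfolding 2 using v(2)[OF _ \<open>j < q\<close>] by (intro append power_word_closed)
    next
      case (3 k j)
      then show ?thesis using u(1) hs(1) by (simp add: free_product_words_def)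
    next
      case (4 k)
      have "replicate n (VarInv (u k)) \<in> free_product_words (carrier H) r"
        using u(1)[OF \<open>k < s\<close>] by (simp add: free_product_words_def in_lists_conv_set)
      then show ?thesis unfolding 4 using v(2)[OF _ hs(2)] by (intro append power_word_closed)
    qed
  qed
  define T where "T i j = tup (\<lambda>l. if l = i then hs j else \<one>) (\<lambda>l. 0)" for i j
  define C where "C k = tup (\<lambda>l. \<one>) (\<lambda>l. int (a k l))" for k
  define y where "y p = (if p < m * q then T (p div q) (p mod q) else C (p - m * q))" for p
  have single: "(\<lambda>l. if l = i then hs j else \<one>) \<in> base" if "i < m" "j < q" for i j
    using that hs by (auto simp: base_def)
  have one: "(\<lambda>l. \<one>) \<in> base" by (simp add: base_def)
  have T: "T i j \<in> carrier ext" if "i < m" "j < q" for i j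
    unfolding T_def by (intro tup_closed single lat_zero that)
  have C: "C k \<in> carrier ext" if "k < s" for k
    unfolding C_def by (intro tup_closed one a that)
  have yv: "y (v i j) = T i j" if "i < m" "j < q" for i j using v[OF that] by (simp add: y_def)
  have yu: "y (u k) = C k" if "k < s" for k using u[OF that] by (simp add: y_def)
  have y: "y \<in> {..<r} \<rightarrow> carrier ext"
  proof
    fix p assume p: "p \<in> {..<r}"
    show "y p \<in> carrier ext"
    proof (cases "p < m * q")
      case True
      then have "p div q < m" "p mod q < q" using hs(2) by (simp_all add: less_mult_imp_div_less)
      then show ?thesis using T True by (simp add: y_def)
    next
      case False
      then have "p - m * q < s" using p by (simp add: r_def)
      then show ?thesis using C False by (simp add: y_def)
    qed
  qed
  interpret diag: group_hom H ext diag
    using diag_hom by (simp add: group_hom_def group_hom_axioms_def is_group group_ext)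
  have prod_T: "gprod ext (\<lambda>i. T i j [^]\<^bsub>ext\<^esub> b i) m =
      tup (\<lambda>l. if l < m then hs j [^] b l else \<one>) (\<lambda>l. 0)" if j: "j < q" for j and b :: "nat \<Rightarrow> nat"
  proof -
    \<comment> \<open>The guard \<open>i < m\<close> keeps \<open>h i\<close> in \<open>base\<close>
      for every i, as \<open>gprod_tup\<close> demands.\<close>
    define h where "h i = (\<lambda>l. if l = i \<and> i < m then hs j [^] b i else \<one>)" for i
    have h: "h i \<in> base" for i using nat_pow_closed[OF hs(1)[OF j]] by (auto simp: base_def h_def)
    have gp: "gprod H (\<lambda>i. h i l) k = (if l < k \<and> l < m then hs j [^] b l else \<one>)" for l k
    proof (induction k)
      case (Suc k)
      have "h k l = (if l = k \<and> l < m then hs j [^] b l else \<one>)" by (simp add: h_def)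
      moreover have "hs j [^] b l \<in> carrier H" by (rule nat_pow_closed[OF hs(1)[OF j]])
      ultimately show ?case using Suc by (cases "l = k") (auto simp: less_Suc_eq)
    qed simp
    have "gprod ext (\<lambda>i. T i j [^]\<^bsub>ext\<^esub> b i) m = gprod ext (\<lambda>i. tup (h i) (\<lambda>l. 0)) m"
    proof (rule gprod_cong)
      fix i assume "i < m"
      have "(\<lambda>l. (if l = i then hs j else \<one>) [^] b i) = h i"
        using \<open>i < m\<close> by (auto simp: h_def)
      then show "T i j [^]\<^bsub>ext\<^esub> b i = tup (h i) (\<lambda>l. 0)"
        using tup_pow[OF single[OF \<open>i < m\<close> j]] by (simp add: T_def)
    qed
    also have "\<dots> = tup (\<lambda>l. gprod H (\<lambda>i. h i l) m) (\<lambda>l. 0)" by (rule gprod_tup[OF h])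
    finally show ?thesis by (simp add: gp)
  qed
  have T_commute: "T i j \<otimes>\<^bsub>ext\<^esub> T i' j' = T i' j' \<otimes>\<^bsub>ext\<^esub> T i j"
    if "i < m" "i' < m" "i \<noteq> i'" "j < q" "j' < q" for i i' j j'
    using that hs(1) by (auto simp: T_def tup_mult intro!: arg_cong2[of _ _ _ _ tup])
  have C_commute: "C k \<otimes>\<^bsub>ext\<^esub> diag g = diag g \<otimes>\<^bsub>ext\<^esub> C k" if "g \<in> carrier H" for k g
    using that by (auto simp: C_def diag_def tup_mult intro!: arg_cong2[of _ _ _ _ tup])
  \<comment> \<open>The n-th power turns \<open>\<zeta>\<close> into z, which is itself the n-th
    power of \<open>hs 0\<close>; from m on the exponents vanish by \<open>supp\<close>.\<close>
  have C_pow: "C k [^]\<^bsub>ext\<^esub> n = tup (\<lambda>l. if l < m then hs 0 [^] (n * a k l) else \<one>) (\<lambda>l. 0)"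
    if "k < s" for k
  proof
    fix l
    have C: "(C k [^]\<^bsub>ext\<^esub> n) l = (z [^] a k l, 0)"
      using n unfolding C_def tup_pow[OF one] by (simp add: tup_def int_pow_int)
    have a0: "a k l = 0" if "\<not> l < m" using supp[OF a[OF \<open>k < s\<close>], of l] that by simp
    have hz: "hs 0 [^] (n * a k l) = z [^] (a k l)"
      using hs(1)[OF hs(2)] hs(3) nat_pow_pow[of "hs 0" n "a k l"] by simp
    have "hs 0 [^] (n * a k l) \<in> carrier H" using hs(1)[OF hs(2)] by simp
    then show "(C k [^]\<^bsub>ext\<^esub> n) l =
        tup (\<lambda>l. if l < m then hs 0 [^] (n * a k l) else \<one>) (\<lambda>l. 0) l"
      unfolding C using a0 hz by (cases "l < m") (simp_all add: tup_def)
  qed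
  have yw: "word_value ext y (map (map_letter diag) w) = \<one>\<^bsub>ext\<^esub>" if "w \<in> W" for w
  proof -
    from \<open>w \<in> W\<close> show ?thesis
    proof (cases rule: W_cases)
      case (1 i j i' j')
      then show ?thesis using T T_commute by (simp add: yv ext.commutator_eq_one_iff)
    next
      case (2 j)
      have "gprod ext (\<lambda>i. y (v i j) [^]\<^bsub>ext\<^esub> (1 :: nat)) m =
          gprod ext (\<lambda>i. T i j [^]\<^bsub>ext\<^esub> (1 :: nat)) m"
        by (rule gprod_cong) (simp add: yv \<open>j < q\<close>)
      also have "\<dots> = diag (hs j)"
        unfolding prod_T[OF \<open>j < q\<close>] using hs(1)[OF \<open>j < q\<close>] by (simp add: diag_def cong: if_cong)
      finally show ?thesis
        using ext.word_value_power_equation[of m y "\<lambda>i. v i j" "diag (hs j)"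
            "Coeff (diag (inv (hs j)))" "\<lambda>i. 1" 1] 2 hs(1) T by (simp add: yv)
    next
      case (3 k j)
      then show ?thesis using C C_commute hs(1) by (simp add: yu ext.commutator_eq_one_iff)
    next
      case (4 k)
      have "gprod ext (\<lambda>i. y (v i 0) [^]\<^bsub>ext\<^esub> (n * a k i)) m =
          gprod ext (\<lambda>i. T i 0 [^]\<^bsub>ext\<^esub> (n * a k i)) m"
        by (rule gprod_cong) (simp add: yv hs(2))
      also have "\<dots> = C k [^]\<^bsub>ext\<^esub> n"
        unfolding prod_T[OF hs(2)] by (rule C_pow[OF \<open>k < s\<close>, symmetric])
      finally show ?thesis
        using ext.word_value_power_equation[of m y "\<lambda>i. v i 0" "C k"
            "VarInv (u k)" "\<lambda>i. n * a k i" n] 4 hs(2) T C by (simp add: yv yu)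
    qed
  qed
  obtain x where x: "x \<in> {..<r} \<rightarrow> carrier H" and xw: "\<And>w. w \<in> W \<Longrightarrow> word_value H x w = \<one>"
    using strongly_verbally_closed_solve[OF is_group svc group_ext diag_hom diag_inj
        diag_verbally_closed W Wr y yw] by blast
  have xc: "x p \<in> carrier H" if "p < r" for p using x that by auto
  show thesis
  proof (rule that[of "\<lambda>i j. x (v i j)" "\<lambda>k. x (u k)"])
    show "x (v i j) \<in> carrier H" if "i < m" "j < q" for i j using xc v that by blast
    show "x (u k) \<in> carrier H" if "k < s" for k using xc u that by blast
    show "x (v i j) \<otimes> x (v i' j') = x (v i' j') \<otimes> x (v i j)"
      if "i < m" "i' < m" "i \<noteq> i'" "j < q" "j' < q" for i i' j j'
    proof -
      have "[Var (v i j), Var (v i' j'), VarInv (v i j), VarInv (v i' j')] \<in> W"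
        unfolding W_def
        by (rule UnI1, rule UnI1, rule UnI1, rule image_eqI[of _ _ "(i, j, i', j')"]) (use that in auto)
      from xw[OF this] show ?thesis using that xc v by (simp add: commutator_eq_one_iff)
    qed
    show "gprod H (\<lambda>i. x (v i j)) m = hs j" if "j < q" for j
    proof -
      have "power_word (\<lambda>i. v i j) (\<lambda>i. 1) m @ replicate 1 (Coeff (inv (hs j))) \<in> W"
        unfolding W_def
        by (rule UnI1, rule UnI1, rule UnI2, rule imageI) (use that in auto)
      from xw[OF this] have "gprod H (\<lambda>i. x (v i j) [^] (1 :: nat)) m = hs j [^] (1 :: nat)"
        using that xc v hs(1) by (subst (asm) word_value_power_equation) auto
      moreover have "gprod H (\<lambda>i. x (v i j) [^] (1 :: nat)) m = gprod H (\<lambda>i. x (v i j)) m"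
        by (rule gprod_cong) (simp add: that xc v)
      ultimately show ?thesis using hs(1)[OF that] by simp
    qed
    show "x (u k) \<otimes> hs j = hs j \<otimes> x (u k)" if "k < s" "j < q" for k j
    proof -
      have "[Var (u k), Coeff (hs j), VarInv (u k), Coeff (inv (hs j))] \<in> W"
        unfolding W_def
        by (rule UnI1, rule UnI2, rule image_eqI[of _ _ "(k, j)"]) (use that in auto)
      from xw[OF this] show ?thesis using that xc u hs by (simp add: commutator_eq_one_iff)
    qed
    show "gprod H (\<lambda>i. x (v i 0) [^] (n * a k i)) m = x (u k) [^] n" if "k < s" for k
    proof -
      have "power_word (\<lambda>i. v i 0) (\<lambda>i. n * a k i) m @ replicate n (VarInv (u k)) \<in> W"
        unfolding W_def by (rule UnI2, rule imageI) (use that in auto)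
      from xw[OF this] show ?thesis
        using that xc v(2)[OF _ hs(2)] u(1)
        by (subst (asm) word_value_power_equation[where g = "x (u k)"]) auto
    qed
  qed
qed

end

section \<open>Products of commuting factors\<close>

context group
begin

lemma commute_gprod:
  assumes "g \<in> carrier G" "\<And>i. i < m \<Longrightarrow> f i \<in> carrier G" "\<And>i. i < m \<Longrightarrow> g \<otimes> f i = f i \<otimes> g"
  shows "g \<otimes> gprod G f m = gprod G f m \<otimes> g"
  using assms
proof (induction m)
  case (Suc m)
  have "g \<otimes> gprod G f m = gprod G f m \<otimes> g" by (rule Suc.IH) (use Suc.prems in auto)
  moreover have "g \<otimes> f m = f m \<otimes> g" by (rule Suc.prems(3)) simp
  moreover have "gprod G f m \<in> carrier G" "f m \<in> carrier G" using Suc.prems(2) by auto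
  ultimately show ?case unfolding gprod.simps using Suc.prems(1) by (metis m_assoc)
qed simp

lemma gprod_pow:
  assumes "\<And>i. i < m \<Longrightarrow> f i \<in> carrier G"
    and "\<And>i i'. i < m \<Longrightarrow> i' < m \<Longrightarrow> i \<noteq> i' \<Longrightarrow> f i \<otimes> f i' = f i' \<otimes> f i"
  shows "gprod G f m [^] (n :: nat) = gprod G (\<lambda>i. f i [^] n) m"
  using assms
proof (induction m)
  case (Suc m)
  have "f m \<otimes> gprod G f m = gprod G f m \<otimes> f m"
    by (rule commute_gprod) (use Suc.prems in auto)
  then have "(gprod G f m \<otimes> f m) [^] n = gprod G f m [^] n \<otimes> f m [^] n"
    using Suc.prems(1) by (intro pow_mult_distrib) auto
  moreover have "gprod G f m [^] n = gprod G (\<lambda>i. f i [^] n) m"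
    by (rule Suc.IH) (use Suc.prems in auto)
  ultimately show ?case by simp
qed simp

lemma gprod_centre:
  "(\<And>i. i < m \<Longrightarrow> f i \<in> centre G) \<Longrightarrow> gprod G f m \<in> centre G"
  by (induction m) (simp_all add: subgroup.one_closed subgroup.m_closed centre_subgroup)

lemma gprod_central_mult:
  assumes "\<And>i. i < m \<Longrightarrow> f i \<in> carrier G" "\<And>i. i < m \<Longrightarrow> g i \<in> centre G"
  shows "gprod G (\<lambda>i. f i \<otimes> g i) m = gprod G f m \<otimes> gprod G g m"
  using assms
proof (induction m)
  case (Suc m)
  have F: "gprod G f m \<in> carrier G" "f m \<in> carrier G" using Suc.prems(1) by auto
  have g: "g m \<in> carrier G" using centreD(1)[OF Suc.prems(2)] by simp
  have P: "gprod G g m \<in> centre G" using Suc.prems(2) by (intro gprod_centre) simp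
  have comm: "gprod G g m \<otimes> f m = f m \<otimes> gprod G g m" by (rule centreD(2)[OF P F(2)])
  have "gprod G f m \<otimes> gprod G g m \<otimes> (f m \<otimes> g m) = gprod G f m \<otimes> (gprod G g m \<otimes> f m) \<otimes> g m"
    using F g centreD(1)[OF P] by (simp add: m_assoc)
  also have "\<dots> = gprod G f m \<otimes> f m \<otimes> (gprod G g m \<otimes> g m)"
    unfolding comm using F g centreD(1)[OF P] by (simp add: m_assoc)
  finally have "gprod G f m \<otimes> gprod G g m \<otimes> (f m \<otimes> g m) =
    gprod G f m \<otimes> f m \<otimes> (gprod G g m \<otimes> g m)" .
  moreover have "gprod G (\<lambda>i. f i \<otimes> g i) m = gprod G f m \<otimes> gprod G g m"
    by (rule Suc.IH) (use Suc.prems in auto)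
  ultimately show ?case by simp
qed simp

text \<open>In the centraliser of g, the factors other than \<open>f i\<close> can be cancelled from
  the product: last factors are stripped until \<open>f i\<close> comes last, then everything before
  it is cancelled at once.\<close>

lemma commute_gprod_factor:
  assumes "g \<in> carrier G" "\<And>l. l < m \<Longrightarrow> f l \<in> carrier G" "i < m"
    and "\<And>l. l < m \<Longrightarrow> l \<noteq> i \<Longrightarrow> g \<otimes> f l = f l \<otimes> g"
    and "g \<otimes> gprod G f m = gprod G f m \<otimes> g"
  shows "g \<otimes> f i = f i \<otimes> g"
  using assms
proof (induction m)
  case (Suc m)
  define D where "D = {x \<in> carrier G. g \<otimes> x = x \<otimes> g}"
  have D: "subgroup D G" unfolding D_def by (rule commutant_subgroup[OF Suc.prems(1)])
  have cl: "gprod G f m \<in> carrier G" "f m \<in> carrier G" using Suc.prems(2) by auto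
  have p: "gprod G f m \<otimes> f m \<in> D" using Suc.prems(5) cl by (simp add: D_def)
  show ?case
  proof (cases "i = m")
    case True
    have "g \<otimes> gprod G f m = gprod G f m \<otimes> g"
      by (rule commute_gprod) (use Suc.prems True in auto)
    then have "gprod G f m \<in> D" using cl by (simp add: D_def)
    from subgroup.m_closed[OF D subgroup.m_inv_closed[OF D this] p] have "f m \<in> D"
      using cl by (simp add: m_assoc[symmetric])
    then show ?thesis using True by (simp add: D_def)
  next
    case False
    have "f m \<in> D" using cl Suc.prems(4)[of m] False by (simp add: D_def)
    from subgroup.m_closed[OF D p subgroup.m_inv_closed[OF D this]] have "gprod G f m \<in> D"
      using cl by (simp add: m_assoc)
    then have "g \<otimes> gprod G f m = gprod G f m \<otimes> g" by (simp add: D_def)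
    then show ?thesis by (intro Suc.IH) (use Suc.prems False in auto)
  qed
qed simp

text \<open>Where \<open>t i\<close> is central, multiplying by the n-th power of the central
  element \<open>t i [^] (1 - int (a i))\<close> corrects its exponent to n; elsewhere the exponent
  already is n. The corrections multiply with c to the desired root.\<close>

lemma central_root_if_few_noncentral:
  fixes n :: nat and a :: "nat \<Rightarrow> nat"
  assumes t: "\<And>i. i < m \<Longrightarrow> t i \<in> carrier G"
      "\<And>i i'. i < m \<Longrightarrow> i' < m \<Longrightarrow> i \<noteq> i' \<Longrightarrow> t i \<otimes> t i' = t i' \<otimes> t i"
    and c: "c \<in> centre G" "gprod G (\<lambda>i. t i [^] (n * a i)) m = c [^] n"
    and a: "\<And>i. i < m \<Longrightarrow> t i \<in> centre G \<or> a i = 1"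
  shows "\<exists>c' \<in> centre G. c' [^] n = gprod G t m [^] n"
proof -
  define b where "b i = (if t i \<in> centre G then t i [^] (1 - int (a i)) else \<one>)" for i
  have b: "b i \<in> centre G" for i
    using centre_int_pow subgroup.one_closed[OF centre_subgroup] by (simp add: b_def)
  have split: "t i [^] n = t i [^] (n * a i) \<otimes> b i [^] n" if i: "i < m" for i
  proof (cases "t i \<in> centre G")
    case True
    have "t i [^] (int (n * a i)) \<otimes> t i [^] ((1 - int (a i)) * int n) = t i [^] int n"
      using t(1)[OF i] by (simp add: int_pow_mult[symmetric] algebra_simps)
    then show ?thesis using True t(1)[OF i]
      by (simp add: b_def int_pow_pow int_pow_int[symmetric])
  next
    case False
    then show ?thesis using a[OF i] t(1)[OF i] by (simp add: b_def)
  qed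
  have B: "gprod G b m \<in> centre G" by (rule gprod_centre[OF b])
  have "gprod G t m [^] n = gprod G (\<lambda>i. t i [^] n) m" by (rule gprod_pow[OF t])
  also have "\<dots> = gprod G (\<lambda>i. t i [^] (n * a i) \<otimes> b i [^] n) m" by (rule gprod_cong[OF split])
  also have "\<dots> = gprod G (\<lambda>i. t i [^] (n * a i)) m \<otimes> gprod G (\<lambda>i. b i [^] n) m"
    using t(1) centre_nat_pow[OF b] by (intro gprod_central_mult) auto
  also have "gprod G (\<lambda>i. b i [^] n) m = gprod G b m [^] n"
    by (rule gprod_pow[OF centreD(1)[OF b] centreD(2)[OF b centreD(1)[OF b]], symmetric])
  also have "gprod G (\<lambda>i. t i [^] (n * a i)) m \<otimes> gprod G b m [^] n = (c \<otimes> gprod G b m) [^] n"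
    unfolding c(2) using centreD(1)[OF c(1)] centreD(1)[OF B]
    by (intro pow_mult_distrib[symmetric] centreD(2)[OF c(1)])
  finally have eq: "gprod G t m [^] n = (c \<otimes> gprod G b m) [^] n" .
  show ?thesis
    by (rule bexI[of _ "c \<otimes> gprod G b m"])
      (rule eq[symmetric], rule subgroup.m_closed[OF centre_subgroup c(1) B])
qed

text \<open>The quotient \<open>p \<otimes> inv c\<close> has trivial n-th power, hence is
  central.\<close>

lemma torsion_central_quotient:
  assumes tc: "torsion_central G" and "n > 0" "p \<in> carrier G" "c \<in> centre G" "p [^] (n :: nat) = c [^] n"
  shows "p \<in> centre G"
proof -
  have c: "c \<in> carrier G" "inv c \<in> centre G"
    using centreD(1) subgroup.m_inv_closed[OF centre_subgroup] assms(4) by auto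
  have "(p \<otimes> inv c) [^] n = p [^] n \<otimes> inv c [^] n"
    using assms(3) c centreD(2)[OF c(2) assms(3)] by (intro pow_mult_distrib) auto
  also have "\<dots> = \<one>" using assms(5) c(1) by (simp add: nat_pow_inv)
  finally have "p \<otimes> inv c \<in> centre G"
    using tc \<open>n > 0\<close> assms(3) c(1) by (auto simp: torsion_central_def)
  then have "p \<otimes> inv c \<otimes> c \<in> centre G"
    using subgroup.m_closed[OF centre_subgroup] assms(4) by blast
  then show ?thesis using assms(3) c(1) by (simp add: m_assoc)
qed

text \<open>The product p of the \<open>t l [^] a l\<close> satisfies
  \<open>p [^] n = c [^] n\<close>, so it is central. Thus g commutes with p and with all its
  factors except possibly the i-th, hence with that one too, which is \<open>t i\<close>.\<close>

lemma torsion_central_factor: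
  fixes n :: nat and a :: "nat \<Rightarrow> nat"
  assumes tc: "torsion_central G" and n: "n > 0"
    and t: "\<And>i. i < m \<Longrightarrow> t i \<in> carrier G"
      "\<And>i i'. i < m \<Longrightarrow> i' < m \<Longrightarrow> i \<noteq> i' \<Longrightarrow> t i \<otimes> t i' = t i' \<otimes> t i"
    and c: "c \<in> centre G" "gprod G (\<lambda>i. t i [^] (n * a i)) m = c [^] n"
    and i: "i < m" "a i = 1"
    and g: "g \<in> carrier G" "\<And>l. l < m \<Longrightarrow> l \<noteq> i \<Longrightarrow> g \<otimes> t l = t l \<otimes> g"
  shows "g \<otimes> t i = t i \<otimes> g"
proof -
  have pow: "x [^] k \<otimes> y = y \<otimes> x [^] k" if "x \<in> carrier G" "y \<in> carrier G" "x \<otimes> y = y \<otimes> x"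
    for x y and k :: nat
    using subgroup_int_pow_closed[OF commutant_subgroup[OF that(2)], of x "int k"] that
    by (simp add: int_pow_int)
  define p where "p = gprod G (\<lambda>l. t l [^] a l) m"
  have p: "p \<in> carrier G" using t(1) by (simp add: p_def)
  have "p [^] n = gprod G (\<lambda>l. (t l [^] a l) [^] n) m"
    unfolding p_def
  proof (rule gprod_pow)
    fix l l' assume l: "l < m" "l' < m" "l \<noteq> l'"
    have "t l [^] a l \<otimes> t l' = t l' \<otimes> t l [^] a l" by (rule pow) (use l t in auto)
    then show "t l [^] a l \<otimes> t l' [^] a l' = t l' [^] a l' \<otimes> t l [^] a l"
      by (intro pow[symmetric]) (use l t in auto)
  qed (use t in auto)
  also have "\<dots> = c [^] n"
    unfolding c(2)[symmetric] by (rule gprod_cong) (simp add: nat_pow_pow t(1) mult.commute)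
  finally have "p \<in> centre G" by (rule torsion_central_quotient[OF tc n p c(1)])
  then have "g \<otimes> p = p \<otimes> g" using centreD(2) g(1) by metis
  then have "g \<otimes> t i [^] a i = t i [^] a i \<otimes> g"
    unfolding p_def using t(1) g i
    by (intro commute_gprod_factor[of g m "\<lambda>l. t l [^] a l" i]) (auto simp: pow)
  then show ?thesis using i t(1) by simp
qed

section \<open>Decomposition into commuting noncentral subgroups\<close>

lemma set_mult_commuting_subgroup:
  assumes A: "subgroup A G" and B: "subgroup B G"
    and comm: "\<And>a b. a \<in> A \<Longrightarrow> b \<in> B \<Longrightarrow> a \<otimes> b = b \<otimes> a"
  shows "subgroup (A <#> B) G" "A \<subseteq> A <#> B" "B \<subseteq> A <#> B"
proof -
  note AG = subgroup.mem_carrier[OF A] and BG = subgroup.mem_carrier[OF B]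
  have memI: "a \<otimes> b \<in> A <#> B" if "a \<in> A" "b \<in> B" for a b
    using that by (auto simp: set_mult_def)
  have memE: thesis if "x \<in> A <#> B" "\<And>a b. a \<in> A \<Longrightarrow> b \<in> B \<Longrightarrow> x = a \<otimes> b \<Longrightarrow> thesis" for x thesis
    using that by (auto simp: set_mult_def)
  show "subgroup (A <#> B) G"
  proof
    show "A <#> B \<subseteq> carrier G" using AG BG by (auto simp: set_mult_def)
    show "\<one> \<in> A <#> B"
      using memI[OF subgroup.one_closed[OF A] subgroup.one_closed[OF B]] by simp
  next
    fix x y assume "x \<in> A <#> B" "y \<in> A <#> B"
    then obtain a b a' b' where x: "a \<in> A" "b \<in> B" "x = a \<otimes> b" "a' \<in> A" "b' \<in> B" "y = a' \<otimes> b'"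
      by (elim memE)
    have "x \<otimes> y = a \<otimes> (b \<otimes> a') \<otimes> b'" using x AG BG by (simp add: m_assoc)
    also have "\<dots> = a \<otimes> (a' \<otimes> b) \<otimes> b'" using comm[OF x(4,2)] by simp
    also have "\<dots> = (a \<otimes> a') \<otimes> (b \<otimes> b')" using x AG BG by (simp add: m_assoc)
    finally show "x \<otimes> y \<in> A <#> B"
      using memI subgroup.m_closed[OF A x(1,4)] subgroup.m_closed[OF B x(2,5)] by simp
  next
    fix x assume "x \<in> A <#> B"
    then obtain a b where x: "a \<in> A" "b \<in> B" "x = a \<otimes> b" by (elim memE)
    have "inv x = inv b \<otimes> inv a" using x AG BG by (simp add: inv_mult_group)
    also have "\<dots> = inv a \<otimes> inv b"
      by (rule comm[OF subgroup.m_inv_closed[OF A x(1)] subgroup.m_inv_closed[OF B x(2)], symmetric])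
    finally show "inv x \<in> A <#> B"
      using memI subgroup.m_inv_closed[OF A x(1)] subgroup.m_inv_closed[OF B x(2)] by simp
  qed
  show "A \<subseteq> A <#> B" using memI[OF _ subgroup.one_closed[OF B]] AG by fastforce
  show "B \<subseteq> A <#> B" using memI[OF subgroup.one_closed[OF A]] BG by fastforce
qed

text \<open>The third conclusion carries the induction: it shows that \<open>K p\<close> commutes
  with the product of the remaining subgroups, so that the two multiply to a subgroup.\<close>

lemma foldr_set_mult_commuting:
  assumes "distinct ps" "\<forall>p \<in> set ps. subgroup (K p) G"
    and "\<forall>p \<in> set ps. \<forall>p' \<in> set ps. p \<noteq> p' \<longrightarrow> (\<forall>a \<in> K p. \<forall>b \<in> K p'. a \<otimes> b = b \<otimes> a)"
  shows "subgroup (foldr (\<lambda>i P. K i <#> P) ps {\<one>}) G \<and>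
    (\<forall>p \<in> set ps. K p \<subseteq> foldr (\<lambda>i P. K i <#> P) ps {\<one>}) \<and>
    (\<forall>g \<in> carrier G. (\<forall>p \<in> set ps. \<forall>a \<in> K p. g \<otimes> a = a \<otimes> g) \<longrightarrow>
      (\<forall>a \<in> foldr (\<lambda>i P. K i <#> P) ps {\<one>}. g \<otimes> a = a \<otimes> g))"
  using assms
proof (induction ps)
  case Nil
  then show ?case using triv_subgroup by simp
next
  case (Cons p ps)
  let ?Q = "foldr (\<lambda>i P. K i <#> P) ps {\<one>}"
  have ps: "distinct ps" "\<forall>p \<in> set ps. subgroup (K p) G"
    and cm: "\<forall>p \<in> set ps. \<forall>p' \<in> set ps. p \<noteq> p' \<longrightarrow> (\<forall>a \<in> K p. \<forall>b \<in> K p'. a \<otimes> b = b \<otimes> a)"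
    using Cons.prems by (simp, simp, meson list.set_intros(2))
  have IH: "subgroup ?Q G" "\<And>p. p \<in> set ps \<Longrightarrow> K p \<subseteq> ?Q"
    "\<And>g a. g \<in> carrier G \<Longrightarrow> (\<And>p a. p \<in> set ps \<Longrightarrow> a \<in> K p \<Longrightarrow> g \<otimes> a = a \<otimes> g) \<Longrightarrow> a \<in> ?Q \<Longrightarrow> g \<otimes> a = a \<otimes> g"
    using Cons.IH[OF ps cm] by blast+
  have Kp: "subgroup (K p) G" using Cons.prems(2) by simp
  have comm: "a \<otimes> b = b \<otimes> a" if "a \<in> K p" "b \<in> ?Q" for a b
  proof (rule IH(3)[OF _ _ that(2)])
    show "a \<in> carrier G" using that(1) subgroup.subset[OF Kp] by blast
    show "a \<otimes> x = x \<otimes> a" if "p' \<in> set ps" "x \<in> K p'" for p' x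
    proof -
      have "p \<noteq> p'" using Cons.prems(1) \<open>p' \<in> set ps\<close> by auto
      then show ?thesis
        using Cons.prems(3) \<open>a \<in> K p\<close> that by (meson list.set_intros)
    qed
  qed
  note S = set_mult_commuting_subgroup[OF Kp IH(1) comm]
  have "g \<otimes> x = x \<otimes> g" if g: "g \<in> carrier G" "\<And>p' a. p' \<in> set (p # ps) \<Longrightarrow> a \<in> K p' \<Longrightarrow> g \<otimes> a = a \<otimes> g"
    and x: "x \<in> K p <#> ?Q" for g x
  proof -
    obtain a b where ab: "a \<in> K p" "b \<in> ?Q" "x = a \<otimes> b" using x by (auto simp: set_mult_def)
    have "g \<otimes> a = a \<otimes> g" by (rule g(2)[OF _ ab(1)]) simp
    moreover have "g \<otimes> b = b \<otimes> g" by (rule IH(3)[OF g(1) _ ab(2)]) (rule g(2), simp_all)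
    moreover have "a \<in> carrier G" "b \<in> carrier G"
      using ab subgroup.subset[OF Kp] subgroup.subset[OF IH(1)] by auto
    ultimately show ?thesis unfolding ab(3) using g(1) by (metis m_assoc)
  qed
  moreover have "K p' \<subseteq> K p <#> ?Q" if "p' \<in> set (p # ps)" for p'
  proof (cases "p' = p")
    case False
    then have "K p' \<subseteq> ?Q" using that by (intro IH(2)) simp
    then show ?thesis using S(3) by (rule subset_trans)
  qed (use S(2) in simp)
  ultimately show ?case unfolding foldr.simps comp_def using S(1) by blast
qed

text \<open>The m indices are sorted into N classes, each containing a noncentral factor. Subgroups
  generated by different classes commute because their generators belong to different indices, and
  together they contain generators of the whole group.\<close>

lemma decomposition_if_many_noncentral:
  fixes t :: "nat \<Rightarrow> nat \<Rightarrow> 'a"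
  assumes t: "\<And>i j. i < m \<Longrightarrow> j < q \<Longrightarrow> t i j \<in> carrier G"
      "\<And>i i' j j'. i < m \<Longrightarrow> i' < m \<Longrightarrow> i \<noteq> i' \<Longrightarrow> j < q \<Longrightarrow> j' < q \<Longrightarrow>
        t i j \<otimes> t i' j' = t i' j' \<otimes> t i j"
    and gen: "generate G ((\<lambda>j. gprod G (\<lambda>i. t i j) m) ` {..<q}) = carrier G"
    and N: "0 < N" "N \<le> card {i. i < m \<and> (\<exists>j<q. t i j \<notin> centre G)}"
  shows "\<exists>K :: nat \<Rightarrow> 'a set. (\<forall>i<N. subgroup (K i) G \<and> \<not> K i \<subseteq> centre G) \<and>
    (\<forall>i<N. \<forall>j<N. i \<noteq> j \<longrightarrow> (\<forall>a \<in> K i. \<forall>b \<in> K j. a \<otimes> b = b \<otimes> a)) \<and>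
    carrier G = foldr (\<lambda>i P. K i <#> P) [0..<N] {\<one>}"
proof -
  obtain I where I: "I \<subseteq> {i. i < m \<and> (\<exists>j<q. t i j \<notin> centre G)}" "card I = N" "finite I"
    using obtain_subset_with_card_n[OF N(2)] by blast
  obtain b where b: "bij_betw b {..<N} I"
    using ex_bij_betw_nat_finite[OF I(3)] I(2) by (auto simp: atLeast0LessThan)
  \<comment> \<open>Selected indices get a class each; all others join class 0, which exists because
    N is positive.\<close>
  define \<beta> where "\<beta> i = (if i \<in> I then inv_into {..<N} b i else 0)" for i
  have \<beta>: "\<beta> i < N" for i
    using N(1) b inv_into_into[of i b "{..<N}"] by (auto simp: \<beta>_def bij_betw_def)
  have \<beta>b: "\<beta> (b p) = p" "b p \<in> I" if "p < N" for p
    using b that by (auto simp: \<beta>_def bij_betw_def)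
  define S where "S p = {t i j | i j. i < m \<and> j < q \<and> \<beta> i = p}" for p
  define K where "K p = generate G (S p)" for p
  have S: "S p \<subseteq> carrier G" for p using t(1) by (auto simp: S_def)
  have K: "subgroup (K p) G" for p unfolding K_def by (rule generate_is_subgroup[OF S])
  have SK: "S p \<subseteq> K p" for p by (auto simp: K_def intro: generate.incl)
  have comm: "a \<otimes> b = b \<otimes> a" if "p \<noteq> p'" "a \<in> K p" "b \<in> K p'" for p p' a b
  proof -
    have "x \<otimes> b = b \<otimes> x" if x: "x \<in> S p" for x
    proof (rule commute_generate[OF _ S])
      show "x \<in> carrier G" using x S by blast
      show "b \<in> generate G (S p')" using \<open>b \<in> K p'\<close> by (simp add: K_def)
      show "x \<otimes> y = y \<otimes> x" if "y \<in> S p'" for y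
        using x that \<open>p \<noteq> p'\<close> t(2) unfolding S_def by blast
    qed
    then have "b \<otimes> a = a \<otimes> b"
      using that subgroup.subset[OF K] by (intro commute_generate[OF _ S, of b p a]) (auto simp: K_def)
    then show ?thesis by simp
  qed
  let ?Q = "foldr (\<lambda>i P. K i <#> P) [0..<N] {\<one>}"
  have QK: "\<forall>p \<in> set [0..<N]. subgroup (K p) G" using K by blast
  have Qc: "\<forall>p \<in> set [0..<N]. \<forall>p' \<in> set [0..<N]. p \<noteq> p' \<longrightarrow>
      (\<forall>a \<in> K p. \<forall>b \<in> K p'. a \<otimes> b = b \<otimes> a)"
    using comm by blast
  have Q: "subgroup ?Q G" "\<And>p. p < N \<Longrightarrow> K p \<subseteq> ?Q"
    using foldr_set_mult_commuting[of "[0..<N]" K, OF distinct_upt QK Qc] by auto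
  have tQ: "t i j \<in> ?Q" if "i < m" "j < q" for i j
  proof -
    have "t i j \<in> S (\<beta> i)" using that by (auto simp: S_def)
    then show ?thesis using SK Q(2)[OF \<beta>] by blast
  qed
  have gQ: "gprod G (\<lambda>i. t i j) k \<in> ?Q" if "j < q" "k \<le> m" for j k
    using that(2)
  proof (induction k)
    case 0
    then show ?case using subgroup.one_closed[OF Q(1)] by simp
  next
    case (Suc k)
    then show ?case using subgroup.m_closed[OF Q(1)] tQ \<open>j < q\<close> by simp
  qed
  have "generate G ((\<lambda>j. gprod G (\<lambda>i. t i j) m) ` {..<q}) \<subseteq> ?Q"
    by (rule generate_subgroup_incl[OF _ Q(1)]) (use gQ in auto)
  then have "carrier G \<subseteq> ?Q" unfolding gen .
  then have "carrier G = ?Q" using subgroup.subset[OF Q(1)] by blast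
  moreover have "\<not> K p \<subseteq> centre G" if "p < N" for p
  proof -
    have bp: "\<beta> (b p) = p" "b p \<in> I" using \<beta>b that by auto
    then obtain j where "b p < m" "j < q" "t (b p) j \<notin> centre G" using I(1) by blast
    moreover from this have "t (b p) j \<in> S p" using bp(1) by (auto simp: S_def)
    ultimately show ?thesis using SK by blast
  qed
  ultimately show ?thesis using K comm by (intro exI[of _ K] conjI allI impI ballI)
qed

end

section \<open>From the equations to central roots\<close>

text \<open>The lattice is spanned by the vectors of \<open>covering_code\<close>. The element h
  heads the list of generators since the power equations concern \<open>hs 0\<close>; each
  \<open>c k\<close> commutes with the generators and is therefore central.\<close>

lemma commuting_decomposition:
  fixes H :: "'a monoid" (structure) and n N :: nat
  assumes H: "group H" and fg: "finitely_generated H" and svc: "strongly_verbally_closed H"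
    and h: "h \<in> carrier H" and n: "n > 0" and z: "h [^] n \<in> centre H"
  obtains q m :: nat and t :: "nat \<Rightarrow> nat \<Rightarrow> 'a" and s :: nat
    and c :: "nat \<Rightarrow> 'a" and a :: "nat \<Rightarrow> nat \<Rightarrow> nat"
  where "0 < q" and "\<And>i j. i < m \<Longrightarrow> j < q \<Longrightarrow> t i j \<in> carrier H"
    and "\<And>i i' j j'. i < m \<Longrightarrow> i' < m \<Longrightarrow> i \<noteq> i' \<Longrightarrow> j < q \<Longrightarrow> j' < q \<Longrightarrow>
      t i j \<otimes> t i' j' = t i' j' \<otimes> t i j"
    and "generate H ((\<lambda>j. gprod H (\<lambda>i. t i j) m) ` {..<q}) = carrier H"
    and "gprod H (\<lambda>i. t i 0) m = h"
    and "\<And>k. k < s \<Longrightarrow> c k \<in> centre H"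
    and "\<And>k. k < s \<Longrightarrow> gprod H (\<lambda>i. t i 0 [^] (n * a k i)) m = c k [^] n"
    and "\<And>I. I \<subseteq> {..<m} \<Longrightarrow> card I < N \<Longrightarrow> \<exists>k<s. \<forall>i \<in> I. a k i = 1"
proof -
  interpret group H by fact
  obtain S where S: "finite S" "S \<subseteq> carrier H" "generate H S = carrier H"
    using fg by (auto simp: finitely_generated_def)
  obtain L where L: "set L = S" using finite_list[OF S(1)] by blast
  define q where "q = length (h # L)"
  define hs where "hs j = (h # L) ! j" for j
  have q: "0 < q" by (simp add: q_def)
  have img: "hs ` {..<q} = insert h S"
    unfolding hs_def q_def using L nth_image[of "length (h # L)" "h # L"] by (simp add: atLeast0LessThan)
  then have hs: "hs j \<in> carrier H" if "j < q" for j
    using imageI[of j "{..<q}" hs] that S(2) h by auto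
  have "carrier H \<subseteq> generate H (hs ` {..<q})"
    unfolding img S(3)[symmetric] by (rule mono_generate) auto
  moreover have hsc: "hs ` {..<q} \<subseteq> carrier H" using hs by auto
  ultimately have gen: "generate H (hs ` {..<q}) = carrier H" using generate_incl by blast
  have hs0: "hs 0 = h" by (simp add: hs_def)
  obtain m :: nat and a :: "nat \<Rightarrow> nat \<Rightarrow> nat" and s :: nat
    where cover: "\<And>e :: nat \<Rightarrow> int. \<exists>i<m. int n dvd (\<Sum>k<s. e k * int (a k i))"
    and indep: "\<And>I. I \<subseteq> {..<m} \<Longrightarrow> card I < N \<Longrightarrow> \<exists>k<s. \<forall>i \<in> I. a k i = 1"
    using covering_code[OF n, of N] by blast
  \<comment> \<open>Lattice vectors and generators are cut off at m, as \<open>supp\<close>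
    requires.\<close>
  define vec where "vec e = (\<lambda>l. if l < m then \<Sum>k<s. e k * int (a k l) else 0)" for e
  define a' where "a' k l = (if l < m then a k l else 0)" for k l
  interpret R: root_extension H "h [^] n" n m "range vec"
  proof
    fix r :: nat and c :: "nat \<Rightarrow> int" and E :: "nat \<Rightarrow> nat \<Rightarrow> int"
    assume "\<And>i. i < r \<Longrightarrow> E i \<in> range vec"
    then have "\<forall>i. \<exists>e. i < r \<longrightarrow> E i = vec e" by blast
    then obtain e where e: "\<And>i. i < r \<Longrightarrow> E i = vec (e i)" by metis
    have "(\<Sum>i<r. c i * E i l) = vec (\<lambda>k. \<Sum>i<r. c i * e i k) l" for l
    proof (cases "l < m")
      case True
      have "(\<Sum>i<r. c i * E i l) = (\<Sum>i<r. \<Sum>k<s. c i * e i k * int (a k l))"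
        using True by (simp add: e vec_def sum_distrib_left mult.assoc)
      also have "\<dots> = (\<Sum>k<s. \<Sum>i<r. c i * e i k * int (a k l))" by (rule sum.swap)
      finally show ?thesis using True by (simp add: vec_def sum_distrib_right)
    qed (simp add: e vec_def)
    then show "(\<lambda>l. \<Sum>i<r. c i * E i l) \<in> range vec" by blast
  next
    fix E assume "E \<in> range vec"
    then obtain e where "E = vec e" by blast
    then show "\<exists>l<m. int n dvd E l" using cover[of e] by (auto simp: vec_def)
  qed (use z n in \<open>auto simp: vec_def\<close>)
  have a': "(\<lambda>l. int (a' k l)) \<in> range vec" if "k < s" for k
  proof
    have "(\<Sum>k'<s. of_bool (k' = k) * int (a k' l)) = (\<Sum>k'<s. if k' = k then int (a k' l) else 0)" for l
      by (rule sum.cong) auto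
    then show "(\<lambda>l. int (a' k l)) = vec (\<lambda>k'. of_bool (k' = k))"
      using that by (auto simp: vec_def a'_def)
  qed simp
  show thesis
  proof (rule R.solve_system[OF svc hs q _ a'])
    show "hs 0 [^] n = h [^] n" by (simp add: hs0)
  next
    fix t c
    assume t: "\<And>i j. i < m \<Longrightarrow> j < q \<Longrightarrow> t i j \<in> carrier H"
      "\<And>i i' j j'. i < m \<Longrightarrow> i' < m \<Longrightarrow> i \<noteq> i' \<Longrightarrow> j < q \<Longrightarrow> j' < q \<Longrightarrow>
        t i j \<otimes> t i' j' = t i' j' \<otimes> t i j"
      "\<And>j. j < q \<Longrightarrow> gprod H (\<lambda>i. t i j) m = hs j"
    and c: "\<And>k. k < s \<Longrightarrow> c k \<in> carrier H"
      "\<And>k j. k < s \<Longrightarrow> j < q \<Longrightarrow> c k \<otimes> hs j = hs j \<otimes> c k"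
      "\<And>k. k < s \<Longrightarrow> gprod H (\<lambda>i. t i 0 [^] (n * a' k i)) m = c k [^] n"
    show thesis
    proof (rule that[OF q t(1,2)])
      have "(\<lambda>j. gprod H (\<lambda>i. t i j) m) ` {..<q} = hs ` {..<q}" using t(3) by (intro image_cong) auto
      then show "generate H ((\<lambda>j. gprod H (\<lambda>i. t i j) m) ` {..<q}) = carrier H" using gen by simp
      show "gprod H (\<lambda>i. t i 0) m = h" using t(3)[OF q] hs0 by simp
      show "c k \<in> centre H" if "k < s" for k
      proof -
        have "c k \<otimes> g = g \<otimes> c k" if "g \<in> carrier H" for g
          using commute_generate[OF c(1)[OF \<open>k < s\<close>] hsc, of g] c(2)[OF \<open>k < s\<close>] that gen by auto
        then show ?thesis using c(1)[OF that] by (simp add: centre_def)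
      qed
      show "gprod H (\<lambda>i. t i 0 [^] (n * a' k i)) m = c k [^] n" if "k < s" for k by (rule c(3)[OF that])
      show "\<exists>k<s. \<forall>i \<in> I. a' k i = 1" if I: "I \<subseteq> {..<m}" "card I < N" for I
      proof -
        obtain k where "k < s" "\<forall>i \<in> I. a k i = 1" using indep[OF I] by blast
        then show ?thesis using I(1) by (intro exI[of _ k]) (auto simp: a'_def)
      qed
    qed
  qed
qed

text \<open>With central torsion, h itself turns out to be central. Otherwise some N admits no
  decomposition into N commuting noncentral subgroups, so fewer than N indices have noncentral
  factors, and a vector that is 1 on all of them gives the root.\<close>

lemma central_root:
  fixes H :: "'a monoid" (structure) and n :: nat
  assumes H: "group H" and fg: "finitely_generated H" and svc: "strongly_verbally_closed H"
    and cond: "torsion_central H \<or> \<not> infinitely_decomposable H"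
    and h: "h \<in> carrier H" and n: "n > 0" and z: "h [^] n \<in> centre H"
  shows "\<exists>c \<in> centre H. c [^] n = h [^] n"
proof (cases "torsion_central H")
  case True
  interpret group H by fact
  obtain q m :: nat and t :: "nat \<Rightarrow> nat \<Rightarrow> 'a" and s :: nat
    and c :: "nat \<Rightarrow> 'a" and a :: "nat \<Rightarrow> nat \<Rightarrow> nat"
    where q: "0 < q" and t: "\<And>i j. i < m \<Longrightarrow> j < q \<Longrightarrow> t i j \<in> carrier H"
      "\<And>i i' j j'. i < m \<Longrightarrow> i' < m \<Longrightarrow> i \<noteq> i' \<Longrightarrow> j < q \<Longrightarrow> j' < q \<Longrightarrow>
        t i j \<otimes> t i' j' = t i' j' \<otimes> t i j"
      "generate H ((\<lambda>j. gprod H (\<lambda>i. t i j) m) ` {..<q}) = carrier H"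
      "gprod H (\<lambda>i. t i 0) m = h"
    and c: "\<And>k. k < s \<Longrightarrow> c k \<in> centre H"
      "\<And>k. k < s \<Longrightarrow> gprod H (\<lambda>i. t i 0 [^] (n * a k i)) m = c k [^] n"
    and indep: "\<And>I. I \<subseteq> {..<m} \<Longrightarrow> card I < 2 \<Longrightarrow> \<exists>k<s. \<forall>i \<in> I. a k i = 1"
    \<comment> \<open>The value 2 suffices because indices are treated one at a time.\<close>
    by (rule commuting_decomposition[OF H fg svc h n z, of 2]) blast
  have "t i 0 \<in> centre H" if i: "i < m" for i
  proof -
    obtain k where k: "k < s" "a k i = 1" using indep[of "{i}"] i by auto
    have tt: "t i 0 \<otimes> t i' j = t i' j \<otimes> t i 0" if "i' < m" and j: "j < q" for i' j
    proof (cases "i' = i")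
      case True
      \<comment> \<open>No equation of the system relates factors with the same index. Here
        \<open>t i j\<close> commutes with every other \<open>t l 0\<close>, and central torsion
        supplies the remaining case.\<close>
      have "t i j \<otimes> t i 0 = t i 0 \<otimes> t i j"
      proof (rule torsion_central_factor[where t = "\<lambda>l. t l 0",
            OF \<open>torsion_central H\<close> n _ _ c(1)[OF k(1)] c(2)[OF k(1)] i k(2)])
        show "t l 0 \<in> carrier H" if "l < m" for l by (rule t(1)[OF that q])
        show "t l 0 \<otimes> t l' 0 = t l' 0 \<otimes> t l 0" if "l < m" "l' < m" "l \<noteq> l'" for l l'
          by (rule t(2)[OF that q q])
        show "t i j \<in> carrier H" by (rule t(1)[OF i j])
        show "t i j \<otimes> t l 0 = t l 0 \<otimes> t i j" if "l < m" "l \<noteq> i" for l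
          by (rule t(2)[OF i that(1) that(2)[symmetric] j q])
      qed
      then show ?thesis using True by simp
    next
      case False
      then show ?thesis by (intro t(2)[OF i that(1) _ q j]) simp
    qed
    have comm: "t i 0 \<otimes> gprod H (\<lambda>i. t i j) m = gprod H (\<lambda>i. t i j) m \<otimes> t i 0" if j: "j < q" for j
      by (rule commute_gprod[OF t(1)[OF i q] t(1)[OF _ j] tt[OF _ j]])
    have "t i 0 \<otimes> g = g \<otimes> t i 0" if "g \<in> carrier H" for g
    proof (rule commute_generate[OF t(1)[OF i q]])
      show "(\<lambda>j. gprod H (\<lambda>i. t i j) m) ` {..<q} \<subseteq> carrier H" using t(1) by auto
      show "t i 0 \<otimes> x = x \<otimes> t i 0" if "x \<in> (\<lambda>j. gprod H (\<lambda>i. t i j) m) ` {..<q}" for x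
        using that comm by blast
      show "g \<in> generate H ((\<lambda>j. gprod H (\<lambda>i. t i j) m) ` {..<q})" using that t(3) by simp
    qed
    then show ?thesis using t(1) i q by (simp add: centre_def)
  qed
  then have "h \<in> centre H" using gprod_centre[of m "\<lambda>i. t i 0"] t(4) by simp
  then show ?thesis by blast
next
  case False
  interpret group H by fact
  obtain N where N: "N > 0" "\<nexists>K :: nat \<Rightarrow> 'a set. (\<forall>i<N. subgroup (K i) H \<and> \<not> K i \<subseteq> centre H) \<and>
    (\<forall>i<N. \<forall>j<N. i \<noteq> j \<longrightarrow> (\<forall>a \<in> K i. \<forall>b \<in> K j. a \<otimes> b = b \<otimes> a)) \<and>
    carrier H = foldr (\<lambda>i P. K i <#> P) [0..<N] {\<one>}"
    using False cond unfolding infinitely_decomposable_def by blast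
  obtain q m :: nat and t :: "nat \<Rightarrow> nat \<Rightarrow> 'a" and s :: nat
    and c :: "nat \<Rightarrow> 'a" and a :: "nat \<Rightarrow> nat \<Rightarrow> nat"
    where q: "0 < q" and t: "\<And>i j. i < m \<Longrightarrow> j < q \<Longrightarrow> t i j \<in> carrier H"
      "\<And>i i' j j'. i < m \<Longrightarrow> i' < m \<Longrightarrow> i \<noteq> i' \<Longrightarrow> j < q \<Longrightarrow> j' < q \<Longrightarrow>
        t i j \<otimes> t i' j' = t i' j' \<otimes> t i j"
      "generate H ((\<lambda>j. gprod H (\<lambda>i. t i j) m) ` {..<q}) = carrier H"
      "gprod H (\<lambda>i. t i 0) m = h"
    and c: "\<And>k. k < s \<Longrightarrow> c k \<in> centre H"
      "\<And>k. k < s \<Longrightarrow> gprod H (\<lambda>i. t i 0 [^] (n * a k i)) m = c k [^] n"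
    and indep: "\<And>I. I \<subseteq> {..<m} \<Longrightarrow> card I < N \<Longrightarrow> \<exists>k<s. \<forall>i \<in> I. a k i = 1"
    by (rule commuting_decomposition[OF H fg svc h n z, of N]) blast
  \<comment> \<open>Outside \<open>I\<close> every \<open>t i j\<close> is central, in particular
    \<open>t i 0\<close>.\<close>
  define I where "I = {i. i < m \<and> (\<exists>j<q. t i j \<notin> centre H)}"
  have "\<not> N \<le> card I"
    using decomposition_if_many_noncentral[OF t(1,2,3) N(1)] N(2) unfolding I_def by blast
  moreover have "I \<subseteq> {..<m}" by (auto simp: I_def)
  ultimately obtain k where k: "k < s" "\<forall>i \<in> I. a k i = 1" using indep[of I] by auto
  have "\<exists>c' \<in> centre H. c' [^] n = gprod H (\<lambda>i. t i 0) m [^] n"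
  proof (rule central_root_if_few_noncentral[OF _ _ c(1)[OF k(1)] c(2)[OF k(1)]])
    show "t i 0 \<in> centre H \<or> a k i = 1" if "i < m" for i
      using k(2) that q by (auto simp: I_def)
  qed (use t q in auto)
  then show ?thesis using t(4) by simp
qed

theorem mainTheorem1:
  fixes H :: "'a monoid"
  assumes "group H"
    and "finitely_generated H"
    and "strongly_verbally_closed H"
  shows "(torsion_central H \<or> \<not> infinitely_decomposable H \<longrightarrow> pure_subgroup (centre H) H) \<and>
    (torsion_central H \<longrightarrow> (pure_subgroup (centre H) H \<longleftrightarrow> isolated_subgroup (centre H) H))"
proof -
  interpret group H by fact
  have nat_root: "\<exists>c \<in> centre H. c [^]\<^bsub>H\<^esub> n = x [^]\<^bsub>H\<^esub> n"
    if "torsion_central H \<or> \<not> infinitely_decomposable H" "x \<in> carrier H" "x [^]\<^bsub>H\<^esub> n \<in> centre H"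
    for x and n :: nat
  proof (cases "n = 0")
    case True
    then show ?thesis using subgroup.one_closed[OF centre_subgroup] by (intro bexI[of _ "\<one>\<^bsub>H\<^esub>"]) simp_all
  next
    case False
    then show ?thesis by (intro central_root[OF assms that(1,2) _ that(3)]) simp
  qed
  have pure: "pure_subgroup (centre H) H" if cond: "torsion_central H \<or> \<not> infinitely_decomposable H"
  proof -
    have "\<exists>c \<in> centre H. c [^]\<^bsub>H\<^esub> k = x [^]\<^bsub>H\<^esub> k"
      if x: "x \<in> carrier H" "x [^]\<^bsub>H\<^esub> k \<in> centre H" for x and k :: int
    proof (cases k rule: int_cases2)
      case (nonneg n)
      then show ?thesis using nat_root[OF cond x(1), of n] x(2) by (simp add: int_pow_int)
    next
      case (nonpos n)
      have "x [^]\<^bsub>H\<^esub> n = inv\<^bsub>H\<^esub> (x [^]\<^bsub>H\<^esub> k)" using x(1) by (simp add: nonpos int_pow_neg_int)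
      then have "x [^]\<^bsub>H\<^esub> n \<in> centre H"
        using subgroup.m_inv_closed[OF centre_subgroup x(2)] by (rule ssubst)
      then obtain c where c: "c \<in> centre H" "c [^]\<^bsub>H\<^esub> n = x [^]\<^bsub>H\<^esub> n"
        using nat_root[OF cond x(1)] by blast
      then have "c [^]\<^bsub>H\<^esub> k = x [^]\<^bsub>H\<^esub> k"
        using x(1) centreD(1)[OF c(1)] by (simp add: nonpos int_pow_neg_int)
      then show ?thesis using c(1) by blast
    qed
    then have "(\<exists>x \<in> carrier H. x [^]\<^bsub>H\<^esub> k = b) \<longleftrightarrow> (\<exists>c \<in> centre H. c [^]\<^bsub>H\<^esub> k = b)"
      if "b \<in> centre H" for b and k :: int
      using that centreD(1) by blast
    then show ?thesis using centre_subgroup by (simp add: pure_subgroup_def)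
  qed
  \<comment> \<open>An element with a central n-th power differs from a central root of that power
    by a torsion element.\<close>
  have isolated: "isolated_subgroup (centre H) H" if tc: "torsion_central H"
  proof -
    have nat_case: "x \<in> centre H" if x: "x \<in> carrier H" "n > 0" "x [^]\<^bsub>H\<^esub> n \<in> centre H" for x and n :: nat
    proof -
      obtain c where "c \<in> centre H" "c [^]\<^bsub>H\<^esub> n = x [^]\<^bsub>H\<^esub> n"
        using nat_root[OF disjI1[OF tc] x(1,3)] by blast
      then show ?thesis by (intro torsion_central_quotient[OF tc x(2,1), of c]) simp_all
    qed
    have "x \<in> centre H" if x: "x \<in> carrier H" "x [^]\<^bsub>H\<^esub> k \<in> centre H" and k: "k \<noteq> 0" for x and k :: int
    proof (cases k rule: int_cases2)
      case (nonneg n)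
      then show ?thesis using nat_case[OF x(1), of n] x(2) k by (simp add: int_pow_int)
    next
      case (nonpos n)
      have "x [^]\<^bsub>H\<^esub> n = inv\<^bsub>H\<^esub> (x [^]\<^bsub>H\<^esub> k)" using x(1) by (simp add: nonpos int_pow_neg_int)
      then have "x [^]\<^bsub>H\<^esub> n \<in> centre H"
        using subgroup.m_inv_closed[OF centre_subgroup x(2)] by (rule ssubst)
      then show ?thesis using nat_case[OF x(1), of n] k nonpos by simp
    qed
    then show ?thesis using centre_subgroup by (auto simp: isolated_subgroup_def)
  qed
  \<comment> \<open>With central torsion both sides of the equivalence hold.\<close>
  show ?thesis using pure isolated by blast
qed

end
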